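(* Let $(\tau,Z,\gamma,h)$ be an integrable Aristotelian structure on an $n$-dimensional manifold $M^n$, given by a $\mathsf{G}_{\mathtt A}$-structure $\pi\colon P\to M^n$, and let $\mathcal{F}$ be the codimension one foliation of $M^n$ with $T\mathcal{F}=\ker\tau$. If the Godbillon-Vey class $\mathtt{GV}(\mathcal{F})=[\alpha\wedge\mathrm{d}\alpha]\in H^3(M^n;\mathbb{R})$ is non-zero, where $\mathrm{d}\tau=\tau\wedge\alpha$, then the torsion $\Theta=\mathrm{d}\vartheta+\omega\wedge\vartheta$ cannot vanish identically for any Ehresmann connection $\omega$ on $P$; consequently the $\mathsf{G}_{\mathtt A}$-structure is not integrable.
   Context: An Aristotelian structure on $M^n$ is a quadruple $(\tau,Z,\gamma,h)$: a nowhere-vanishing one-form $\tau$, a vector field $Z$ with $\iota_Z\tau=1$, a corank one positive-semidefinite symmetric tensor $\gamma\in\Gamma(\odot^2TM^n)$ with $\iota_\tau\gamma=0$, and a corank one positive-semidefinite symmetric tensor $h\in\Gamma(\odot^2T^*M^n)$ with $\iota_Zh=0$. It is called an integrable Aristotelian structure if $\tau\wedge\mathrm{d}\tau=0$; then $\mathrm{d}\tau=\tau\wedge\alpha$ for some one-form $\alpha$, and $[\alpha\wedge\mathrm{d}\alpha]$ is independent of the choice of $\alpha$. The structure corresponds to a reduction $\pi\colon P\to M^n$ of the frame bundle to $\mathsf{G}_{\mathtt A}=\{\mathrm{diag}(1,\mathsf{A}):\mathsf{A}\in\mathsf{O}(n-1)\}\subset\mathsf{GL}(n,\mathbb{R})$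 with Lie algebra $\mathfrak{g}_{\mathtt A}\subset\mathfrak{gl}(n,\mathbb{R})$. The soldering form $\vartheta\in\Omega^1(P,\mathbb{R}^n)$ is $\vartheta_u(X)=u^{-1}(\pi_*X)$, where a point $u\in P$ over $x$ is regarded as a linear isomorphism $u\colon\mathbb{R}^n\to T_xM^n$. A $\mathsf{G}$-structure is integrable if $M^n$ has an open cover on each set of which the $\mathsf{G}$-structure is isomorphic to the standard flat $\mathsf{G}$-structure on $\mathbb{R}^n$ (equivalently, there is an atlas whose coordinate frames are $\mathsf{G}$-frames). *)

theory Defs
  imports "HOL-Analysis.Analysis"
begin

section \<open>Smooth functions on open subsets of Euclidean space\<close>

primrec Ck_on :: "nat \<Rightarrow> 'e::euclidean_space set \<Rightarrow> ('e \<Rightarrow> 'b::real_normed_vector) \<Rightarrow> bool" where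
  "Ck_on 0 S f \<longleftrightarrow> continuous_on S f"
| "Ck_on (Suc k) S f \<longleftrightarrow>
     f differentiable_on S \<and> (\<forall>w. Ck_on k S (\<lambda>y. frechet_derivative f (at y) w))"

text \<open>Used only for open \<open>S\<close>.\<close>

definition smooth_on :: "'e::euclidean_space set \<Rightarrow> ('e \<Rightarrow> 'b::real_normed_vector) \<Rightarrow> bool" where
  "smooth_on S f \<longleftrightarrow> (\<forall>k. Ck_on k S f)"

section \<open>Smooth manifolds\<close>

text \<open>A chart is a pair of its domain and its coordinate map; values of the coordinate map outside
  the domain are irrelevant. The model space is a Euclidean type, so the dimension is
  \<open>DIM('e)\<close>.\<close>

type_synonym ('a, 'e) chart = "'a set \<times> ('a \<Rightarrow> 'e)"

abbreviation chart_inv :: "('a, 'e) chart \<Rightarrow> 'e \<Rightarrow> 'a" where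
  "chart_inv c \<equiv> inv_into (fst c) (snd c)"

definition is_chart :: "('a, 'e::euclidean_space) chart \<Rightarrow> bool" where
  "is_chart c \<longleftrightarrow> inj_on (snd c) (fst c) \<and> open (snd c ` fst c)"

definition compatible :: "('a, 'e::euclidean_space) chart \<Rightarrow> ('a, 'e) chart \<Rightarrow> bool" where
  "compatible c d \<longleftrightarrow>
     open (snd c ` (fst c \<inter> fst d)) \<and> open (snd d ` (fst c \<inter> fst d)) \<and>
     smooth_on (snd c ` (fst c \<inter> fst d)) (snd d \<circ> chart_inv c) \<and>
     smooth_on (snd d ` (fst c \<inter> fst d)) (snd c \<circ> chart_inv d)"

definition smooth_atlas :: "('a, 'e::euclidean_space) chart set \<Rightarrow> bool" where
  "smooth_atlas A \<longleftrightarrow> (\<forall>c\<in>A. is_chart c) \<and> (\<forall>c\<in>A. \<forall>d\<in>A. compatible c d)"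

definition carrier :: "('a, 'e) chart set \<Rightarrow> 'a set" where
  "carrier A = (\<Union>c\<in>A. fst c)"

definition maximal_atlas :: "('a, 'e::euclidean_space) chart set \<Rightarrow> bool" where
  "maximal_atlas A \<longleftrightarrow> smooth_atlas A \<and>
     (\<forall>d. is_chart d \<and> fst d \<subseteq> carrier A \<and> (\<forall>c\<in>A. compatible c d) \<longrightarrow> d \<in> A)"

definition atlas_open :: "('a, 'e::euclidean_space) chart set \<Rightarrow> 'a set \<Rightarrow> bool" where
  "atlas_open A W \<longleftrightarrow> W \<subseteq> carrier A \<and> (\<forall>c\<in>A. open (snd c ` (W \<inter> fst c)))"

definition manifold_topology :: "('a, 'e::euclidean_space) chart set \<Rightarrow> 'a topology" where
  "manifold_topology A = topology (atlas_open A)"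

lemma openin_manifold_topology:
  assumes "smooth_atlas A"
  shows "openin (manifold_topology A) = atlas_open A"
proof -
  have inj: "inj_on (snd c) (fst c)" if "c \<in> A" for c
    using assms that by (auto simp: smooth_atlas_def is_chart_def)
  have "istopology (atlas_open A)"
    unfolding istopology_def
  proof (intro conjI allI impI)
    fix S T assume S: "atlas_open A S" and T: "atlas_open A T"
    show "atlas_open A (S \<inter> T)"
      unfolding atlas_open_def
    proof (intro conjI ballI)
      show "S \<inter> T \<subseteq> carrier A" using S by (auto simp: atlas_open_def)
      fix c assume c: "c \<in> A"
      have "snd c ` (S \<inter> T \<inter> fst c) = snd c ` ((S \<inter> fst c) \<inter> (T \<inter> fst c))"
        by (rule arg_cong[where f = "image (snd c)"]) blast
      also have "\<dots> = snd c ` (S \<inter> fst c) \<inter> snd c ` (T \<inter> fst c)"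
        by (rule inj_on_image_Int[OF inj[OF c]]) auto
      finally show "open (snd c ` (S \<inter> T \<inter> fst c))"
        using S T c by (auto simp: atlas_open_def)
    qed
  next
    fix K assume K: "\<forall>S\<in>K. atlas_open A S"
    show "atlas_open A (\<Union>K)"
      unfolding atlas_open_def
    proof (intro conjI ballI)
      show "\<Union>K \<subseteq> carrier A" using K by (auto simp: atlas_open_def)
      fix c assume c: "c \<in> A"
      have "snd c ` (\<Union>K \<inter> fst c) = (\<Union>S\<in>K. snd c ` (S \<inter> fst c))" by blast
      then show "open (snd c ` (\<Union>K \<inter> fst c))"
        using K c by (auto simp: atlas_open_def)
    qed
  qed
  then show ?thesis
    by (simp add: manifold_topology_def topology_inverse')
qed

definition manifold_atlas :: "('a, 'e::euclidean_space) chart set \<Rightarrow> bool" where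
  "manifold_atlas A \<longleftrightarrow> smooth_atlas A \<and>
     Hausdorff_space (manifold_topology A) \<and> second_countable (manifold_topology A)"

text \<open>A smooth manifold, given by its maximal atlas.\<close>

definition smooth_manifold :: "('a, 'e::euclidean_space) chart set \<Rightarrow> bool" where
  "smooth_manifold A \<longleftrightarrow> manifold_atlas A \<and> maximal_atlas A"

definition smooth_map_on ::
  "('a, 'e::euclidean_space) chart set \<Rightarrow> ('b, 'f::euclidean_space) chart set \<Rightarrow> 'a set \<Rightarrow> ('a \<Rightarrow> 'b) \<Rightarrow> bool"
  where
  "smooth_map_on A B U f \<longleftrightarrow>
     continuous_map (subtopology (manifold_topology A) U) (manifold_topology B) f \<and>
     (\<forall>c\<in>A. \<forall>d\<in>B. smooth_on (snd c ` (fst c \<inter> U \<inter> f -` fst d)) (snd d \<circ> f \<circ> chart_inv c))"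

section \<open>Tangent and cotangent spaces\<close>

text \<open>A tangent vector at \<open>x\<close> is the family of its components in all charts of the atlas around
  \<open>x\<close>, subject to the usual transformation law; components in other charts are set to zero, so that
  the vector space operations are pointwise.\<close>

type_synonym ('a, 'e) tvec = "('a, 'e) chart \<Rightarrow> 'e"

definition lincomb :: "real \<Rightarrow> ('i \<Rightarrow> 'b::real_vector) \<Rightarrow> real \<Rightarrow> ('i \<Rightarrow> 'b) \<Rightarrow> 'i \<Rightarrow> 'b" where
  "lincomb a v b w = (\<lambda>i. a *\<^sub>R v i + b *\<^sub>R w i)"

definition tangent_space :: "('a, 'e::euclidean_space) chart set \<Rightarrow> 'a \<Rightarrow> ('a, 'e) tvec set" where
  "tangent_space A x = {v.
     (\<forall>c\<in>A. \<forall>d\<in>A. x \<in> fst c \<and> x \<in> fst d \<longrightarrow>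
        v d = frechet_derivative (snd d \<circ> chart_inv c) (at (snd c x)) (v c)) \<and>
     (\<forall>c. \<not> (c \<in> A \<and> x \<in> fst c) \<longrightarrow> v c = 0)}"

text \<open>The tangent vector at \<open>x\<close> whose components in the chart \<open>c\<close> are \<open>w\<close>.\<close>

definition coord_vec ::
  "('a, 'e::euclidean_space) chart set \<Rightarrow> ('a, 'e) chart \<Rightarrow> 'a \<Rightarrow> 'e \<Rightarrow> ('a, 'e) tvec" where
  "coord_vec A c x w = (\<lambda>d. if d \<in> A \<and> x \<in> fst d
     then frechet_derivative (snd d \<circ> chart_inv c) (at (snd c x)) w else 0)"

definition chart_at :: "('a, 'e::euclidean_space) chart set \<Rightarrow> 'a \<Rightarrow> ('a, 'e) chart" where
  "chart_at A x = (SOME c. c \<in> A \<and> x \<in> fst c)"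

definition differential ::
  "('a, 'e::euclidean_space) chart set \<Rightarrow> ('b, 'f::euclidean_space) chart set \<Rightarrow> ('a \<Rightarrow> 'b) \<Rightarrow> 'a
     \<Rightarrow> ('a, 'e) tvec \<Rightarrow> ('b, 'f) tvec" where
  "differential A B f x v = (\<lambda>d. if d \<in> B \<and> f x \<in> fst d
     then (let c = chart_at A x in
        frechet_derivative (snd d \<circ> f \<circ> chart_inv c) (at (snd c x)) (v c)) else 0)"

definition velocity :: "('a, 'e::euclidean_space) chart set \<Rightarrow> (real \<Rightarrow> 'a) \<Rightarrow> ('a, 'e) tvec" where
  "velocity A k = (\<lambda>d. if d \<in> A \<and> k 0 \<in> fst d
     then vector_derivative (\<lambda>t. snd d (k t)) (at 0) else 0)"

definition smooth_embedding ::
  "('a, 'e::euclidean_space) chart set \<Rightarrow> ('b, 'f::euclidean_space) chart set \<Rightarrow> ('a \<Rightarrow> 'b) \<Rightarrow> bool"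
  where
  "smooth_embedding A B f \<longleftrightarrow> smooth_map_on A B (carrier A) f \<and>
     embedding_map (manifold_topology A) (manifold_topology B) f \<and>
     (\<forall>x\<in>carrier A. inj_on (differential A B f x) (tangent_space A x))"

definition smooth_vector_field ::
  "('a, 'e::euclidean_space) chart set \<Rightarrow> ('a \<Rightarrow> ('a, 'e) tvec) \<Rightarrow> bool" where
  "smooth_vector_field A Z \<longleftrightarrow> (\<forall>x\<in>carrier A. Z x \<in> tangent_space A x) \<and>
     (\<forall>c\<in>A. smooth_on (snd c ` fst c) (\<lambda>y. Z (chart_inv c y) c))"

definition cotangent_space ::
  "('a, 'e::euclidean_space) chart set \<Rightarrow> 'a \<Rightarrow> (('a, 'e) tvec \<Rightarrow> real) set" where
  "cotangent_space A x = {\<xi>.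
     (\<forall>v\<in>tangent_space A x. \<forall>w\<in>tangent_space A x. \<forall>a b.
        \<xi> (lincomb a v b w) = a * \<xi> v + b * \<xi> w) \<and>
     (\<forall>v. v \<notin> tangent_space A x \<longrightarrow> \<xi> v = 0)}"

text \<open>The covector with (constant) components \<open>w\<close> in the chart \<open>c\<close>.\<close>

definition coord_covec ::
  "('a, 'e::euclidean_space) chart set \<Rightarrow> ('a, 'e) chart \<Rightarrow> 'a \<Rightarrow> 'e \<Rightarrow> ('a, 'e) tvec \<Rightarrow> real" where
  "coord_covec A c x w = (\<lambda>v. if v \<in> tangent_space A x then w \<bullet> v c else 0)"

section \<open>Differential forms\<close>

text \<open>A \<open>k\<close>-form takes a point and a list of \<open>k\<close> tangent vectors; its values on other arguments are
  irrelevant, and equality of forms is \<open>form_eq\<close>.\<close>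

type_synonym ('a, 'e, 'v) form = "'a \<Rightarrow> ('a, 'e) tvec list \<Rightarrow> 'v"

definition tangent_lists ::
  "('a, 'e::euclidean_space) chart set \<Rightarrow> nat \<Rightarrow> 'a \<Rightarrow> ('a, 'e) tvec list set" where
  "tangent_lists A k x = {vs. length vs = k \<and> set vs \<subseteq> tangent_space A x}"

definition form_eq ::
  "('a, 'e::euclidean_space) chart set \<Rightarrow> nat \<Rightarrow> ('a, 'e, 'v) form \<Rightarrow> ('a, 'e, 'v) form \<Rightarrow> bool" where
  "form_eq A k \<omega> \<eta> \<longleftrightarrow> (\<forall>x\<in>carrier A. \<forall>vs\<in>tangent_lists A k x. \<omega> x vs = \<eta> x vs)"

definition zero_form :: "('a, 'e, 'v::zero) form" where
  "zero_form = (\<lambda>x vs. 0)"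

definition smooth_form ::
  "('a, 'e::euclidean_space) chart set \<Rightarrow> nat \<Rightarrow> ('a, 'e, 'v::real_normed_vector) form \<Rightarrow> bool" where
  "smooth_form A k \<omega> \<longleftrightarrow>
     (\<forall>x\<in>carrier A. \<forall>vs\<in>tangent_lists A k x. \<forall>i<k.
        (\<forall>v\<in>tangent_space A x. \<forall>w\<in>tangent_space A x. \<forall>a b.
           \<omega> x (vs[i := lincomb a v b w]) = a *\<^sub>R \<omega> x (vs[i := v]) + b *\<^sub>R \<omega> x (vs[i := w])) \<and>
        (\<forall>j<k. i \<noteq> j \<and> vs ! i = vs ! j \<longrightarrow> \<omega> x vs = 0)) \<and>
     (\<forall>c\<in>A. \<forall>ws. length ws = k \<longrightarrow>
        smooth_on (snd c ` fst c)
          (\<lambda>y. \<omega> (chart_inv c y) (map (coord_vec A c (chart_inv c y)) ws)))"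

text \<open>Exterior derivative, computed in a chart \<open>c\<close>:
  \<open>(d \<omega>)(v\<^sub>0, \<dots>, v\<^sub>k)\<close> is the alternating sum of the derivatives along \<open>v\<^sub>i\<close> of
  \<open>\<omega>(v\<^sub>0, \<dots>, v\<^sub>k)\<close> with \<open>v\<^sub>i\<close> omitted, the vectors being extended with constant
  components in \<open>c\<close>. For a smooth form the result does not depend on \<open>c\<close>.\<close>

definition ext_deriv ::
  "('a, 'e::euclidean_space) chart set \<Rightarrow> ('a, 'e, 'v::real_normed_vector) form \<Rightarrow> ('a, 'e, 'v) form"
  where
  "ext_deriv A \<omega> x vs = (let c = chart_at A x in
     \<Sum>i<length vs. (-1) ^ i *\<^sub>R
       frechet_derivative
         (\<lambda>y. \<omega> (chart_inv c y)
            (map (\<lambda>v. coord_vec A c (chart_inv c y) (v c)) (take i vs @ drop (Suc i) vs)))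
         (at (snd c x)) ((vs ! i) c))"

text \<open>Wedge product of a \<open>p\<close>-form and a \<open>q\<close>-form with respect to a bilinear pairing of the values,
  normalised so that \<open>(\<alpha> \<and> \<beta>)(v, w) = \<alpha>(v) \<beta>(w) - \<alpha>(w) \<beta>(v)\<close> for one-forms.\<close>

definition wedge ::
  "('u \<Rightarrow> 'v \<Rightarrow> 'w::real_vector) \<Rightarrow> nat \<Rightarrow> nat \<Rightarrow> ('a, 'e, 'u) form \<Rightarrow> ('a, 'e, 'v) form \<Rightarrow> ('a, 'e, 'w) form"
  where
  "wedge bil p q \<alpha> \<beta> x vs = (1 / (fact p * fact q)) *\<^sub>R
     (\<Sum>\<sigma> | \<sigma> permutes {..<p + q}. real_of_int (sign \<sigma>) *\<^sub>R
        bil (\<alpha> x (map (\<lambda>i. vs ! \<sigma> i) [0..<p])) (\<beta> x (map (\<lambda>i. vs ! \<sigma> i) [p..<p + q])))"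

section \<open>De Rham cohomology\<close>

definition closed_form ::
  "('a, 'e::euclidean_space) chart set \<Rightarrow> nat \<Rightarrow> ('a, 'e, real) form \<Rightarrow> bool" where
  "closed_form A k \<omega> \<longleftrightarrow> smooth_form A k \<omega> \<and> form_eq A (Suc k) (ext_deriv A \<omega>) zero_form"

definition exact_form ::
  "('a, 'e::euclidean_space) chart set \<Rightarrow> nat \<Rightarrow> ('a, 'e, real) form \<Rightarrow> bool" where
  "exact_form A k \<omega> \<longleftrightarrow> (if k = 0 then form_eq A k \<omega> zero_form
     else (\<exists>\<beta>. smooth_form A (k - 1) \<beta> \<and> form_eq A k \<omega> (ext_deriv A \<beta>)))"

text \<open>The class in the degree \<open>k\<close> de Rham cohomology of a closed \<open>k\<close>-form, as a coset of the exact
  forms; the zero of the cohomology group is the class of \<open>zero_form\<close>.\<close>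

definition de_rham_class ::
  "('a, 'e::euclidean_space) chart set \<Rightarrow> nat \<Rightarrow> ('a, 'e, real) form \<Rightarrow> ('a, 'e, real) form set" where
  "de_rham_class A k \<omega> = {\<eta>. closed_form A k \<eta> \<and> exact_form A k (\<lambda>x vs. \<eta> x vs - \<omega> x vs)}"

section \<open>Codimension one foliations and the Godbillon--Vey class\<close>

text \<open>The index of the first coordinate of \<open>real ^ 'n\<close>.\<close>

definition ix0 :: "'n::{finite, wellorder}" where
  "ix0 = (LEAST i. True)"

text \<open>A codimension one foliation, given by a foliated atlas: the plaques are the level sets of the
  first coordinate, and locally the first coordinate of one foliated chart is a function of
  the first coordinate of any other.\<close>

definition foliated_atlas ::
  "('a, real ^ 'n::{finite, wellorder}) chart set \<Rightarrow> ('a, real ^ 'n::_) chart set \<Rightarrow> bool" where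
  "foliated_atlas A F \<longleftrightarrow> F \<subseteq> A \<and> carrier F = carrier A \<and>
     (\<forall>c\<in>F. \<forall>d\<in>F. \<forall>x\<in>fst c \<inter> fst d.
        \<exists>W h. open W \<and> snd c x \<in> W \<and> W \<subseteq> snd c ` (fst c \<inter> fst d) \<and>
          (\<forall>y\<in>W. snd d (chart_inv c y) $ ix0 = h (y $ ix0)))"

definition foliation_tangent ::
  "('a, real ^ 'n::{finite, wellorder}) chart set \<Rightarrow> ('a, real ^ 'n::_) chart set \<Rightarrow> 'a
     \<Rightarrow> ('a, real ^ 'n::_) tvec set" where
  "foliation_tangent A F x =
     {v \<in> tangent_space A x. \<forall>c\<in>F. x \<in> fst c \<longrightarrow> v c $ ix0 = 0}"

definition godbillon_vey_class ::
  "('a, 'e::euclidean_space) chart set \<Rightarrow> ('a, 'e, real) form \<Rightarrow> ('a, 'e, real) form set" where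
  "godbillon_vey_class A \<alpha> = de_rham_class A 3 (wedge (*) 1 2 \<alpha> (ext_deriv A \<alpha>))"

section \<open>Aristotelian structures\<close>

definition psd_corank_one ::
  "('i \<Rightarrow> 'b::real_vector) set \<Rightarrow> (('i \<Rightarrow> 'b) \<Rightarrow> ('i \<Rightarrow> 'b) \<Rightarrow> real) \<Rightarrow> bool" where
  "psd_corank_one V B \<longleftrightarrow>
     (\<forall>u\<in>V. \<forall>v\<in>V. \<forall>w\<in>V. \<forall>a b. B (lincomb a u b v) w = a * B u w + b * B v w) \<and>
     (\<forall>v\<in>V. \<forall>w\<in>V. B v w = B w v) \<and>
     (\<forall>v\<in>V. B v v \<ge> 0) \<and>
     (\<exists>k\<in>V. k \<noteq> (\<lambda>i. 0) \<and> {v \<in> V. \<forall>w\<in>V. B v w = 0} = {(\<lambda>i. a *\<^sub>R k i) | a. True})"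

definition covector_of ::
  "('a, 'e::euclidean_space) chart set \<Rightarrow> ('a, 'e, real) form \<Rightarrow> 'a \<Rightarrow> ('a, 'e) tvec \<Rightarrow> real" where
  "covector_of A \<tau> x = (\<lambda>v. if v \<in> tangent_space A x then \<tau> x [v] else 0)"

definition aristotelian_structure ::
  "('a, 'e::euclidean_space) chart set \<Rightarrow> ('a, 'e, real) form \<Rightarrow> ('a \<Rightarrow> ('a, 'e) tvec) \<Rightarrow>
     ('a \<Rightarrow> (('a, 'e) tvec \<Rightarrow> real) \<Rightarrow> (('a, 'e) tvec \<Rightarrow> real) \<Rightarrow> real) \<Rightarrow>
     ('a \<Rightarrow> ('a, 'e) tvec \<Rightarrow> ('a, 'e) tvec \<Rightarrow> real) \<Rightarrow> bool" where
  "aristotelian_structure A \<tau> Z \<gamma> h \<longleftrightarrow>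
     smooth_form A 1 \<tau> \<and> (\<forall>x\<in>carrier A. \<exists>v\<in>tangent_space A x. \<tau> x [v] \<noteq> 0) \<and>
     smooth_vector_field A Z \<and> (\<forall>x\<in>carrier A. \<tau> x [Z x] = 1) \<and>
     (\<forall>x\<in>carrier A. psd_corank_one (cotangent_space A x) (\<gamma> x)) \<and>
     (\<forall>c\<in>A. \<forall>v w. smooth_on (snd c ` fst c)
        (\<lambda>y. \<gamma> (chart_inv c y) (coord_covec A c (chart_inv c y) v) (coord_covec A c (chart_inv c y) w))) \<and>
     (\<forall>x\<in>carrier A. \<forall>\<xi>\<in>cotangent_space A x. \<gamma> x (covector_of A \<tau> x) \<xi> = 0) \<and>
     (\<forall>x\<in>carrier A. psd_corank_one (tangent_space A x) (h x)) \<and>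
     (\<forall>c\<in>A. \<forall>v w. smooth_on (snd c ` fst c)
        (\<lambda>y. h (chart_inv c y) (coord_vec A c (chart_inv c y) v) (coord_vec A c (chart_inv c y) w))) \<and>
     (\<forall>x\<in>carrier A. \<forall>v\<in>tangent_space A x. h x (Z x) v = 0)"

definition integrable_aristotelian_structure ::
  "('a, 'e::euclidean_space) chart set \<Rightarrow> ('a, 'e, real) form \<Rightarrow> ('a \<Rightarrow> ('a, 'e) tvec) \<Rightarrow>
     ('a \<Rightarrow> (('a, 'e) tvec \<Rightarrow> real) \<Rightarrow> (('a, 'e) tvec \<Rightarrow> real) \<Rightarrow> real) \<Rightarrow>
     ('a \<Rightarrow> ('a, 'e) tvec \<Rightarrow> ('a, 'e) tvec \<Rightarrow> real) \<Rightarrow> bool" where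
  "integrable_aristotelian_structure A \<tau> Z \<gamma> h \<longleftrightarrow> aristotelian_structure A \<tau> Z \<gamma> h \<and>
     form_eq A 3 (wedge (*) 1 2 \<tau> (ext_deriv A \<tau>)) zero_form"

section \<open>The frame bundle and \<open>G\<close>-structures\<close>

text \<open>A frame at \<open>x\<close> is a linear isomorphism from \<open>real ^ 'n\<close> to the tangent space at \<open>x\<close>.\<close>

type_synonym ('a, 'n) frame = "'a \<times> (real ^ 'n \<Rightarrow> ('a, real ^ 'n) tvec)"

definition frame_bundle :: "('a, real ^ 'n::finite) chart set \<Rightarrow> ('a, 'n) frame set" where
  "frame_bundle A = {(x, u). x \<in> carrier A \<and> bij_betw u UNIV (tangent_space A x) \<and>
     (\<forall>a v b w. u (a *\<^sub>R v + b *\<^sub>R w) = lincomb a (u v) b (u w))}"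

definition frame_matrix :: "('a, real ^ 'n::finite) chart \<Rightarrow> ('a, 'n) frame \<Rightarrow> real ^ 'n ^ 'n" where
  "frame_matrix c p = matrix (\<lambda>w. snd p w c)"

definition frame_atlas ::
  "('a, real ^ 'n::finite) chart set \<Rightarrow> (('a, 'n) frame, (real ^ 'n) \<times> (real ^ 'n ^ 'n)) chart set" where
  "frame_atlas A =
     (\<lambda>c. ({p \<in> frame_bundle A. fst p \<in> fst c}, \<lambda>p. (snd c (fst p), frame_matrix c p))) ` A"

definition frame_act :: "real ^ 'n ^ 'n::finite \<Rightarrow> ('a, 'n) frame \<Rightarrow> ('a, 'n) frame" where
  "frame_act g p = (fst p, \<lambda>w. snd p (g *v w))"

text \<open>\<open>G_structure A G P \<P>\<close>: the set \<open>P\<close> of frames is a reduction of the frame bundle to the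
  structure group \<open>G\<close>, and \<open>\<P>\<close> is an atlas for the smooth structure of \<open>P\<close> as an embedded
  submanifold of the frame bundle.\<close>

definition G_structure ::
  "('a, real ^ 'n::finite) chart set \<Rightarrow> (real ^ 'n ^ 'n) set \<Rightarrow> ('a, 'n) frame set \<Rightarrow>
     (('a, 'n) frame, 'p::euclidean_space) chart set \<Rightarrow> bool" where
  "G_structure A G P \<P> \<longleftrightarrow>
     P \<subseteq> frame_bundle A \<and>
     manifold_atlas \<P> \<and> carrier \<P> = P \<and> smooth_embedding \<P> (frame_atlas A) (\<lambda>p. p) \<and>
     (\<forall>p\<in>P. \<forall>q\<in>frame_bundle A. fst q = fst p \<longrightarrow> (q \<in> P \<longleftrightarrow> (\<exists>g\<in>G. q = frame_act g p))) \<and>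
     (\<forall>x\<in>carrier A. \<exists>U s. openin (manifold_topology A) U \<and> x \<in> U \<and>
        smooth_map_on A \<P> U s \<and> (\<forall>y\<in>U. fst (s y) = y))"

text \<open>Over the domain of the chart \<open>c\<close> the \<open>G\<close>-structure is isomorphic, via \<open>c\<close>, to the standard
  flat one (restricted to an open subset), whose frames are the matrices in \<open>G\<close>.\<close>

definition integrable_G_structure ::
  "('a, real ^ 'n::finite) chart set \<Rightarrow> (real ^ 'n ^ 'n) set \<Rightarrow> ('a, 'n) frame set \<Rightarrow> bool" where
  "integrable_G_structure A G P \<longleftrightarrow>
     (\<forall>x\<in>carrier A. \<exists>c\<in>A. x \<in> fst c \<and>
        (\<forall>p\<in>frame_bundle A. fst p \<in> fst c \<longrightarrow> (p \<in> P \<longleftrightarrow> frame_matrix c p \<in> G)))"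

text \<open>The Lie algebra as the tangent space at the identity.\<close>

definition lie_algebra :: "(real ^ 'n ^ 'n::finite) set \<Rightarrow> (real ^ 'n ^ 'n) set" where
  "lie_algebra G = {X. \<exists>k. (\<forall>t. k t \<in> G) \<and> k 0 = mat 1 \<and> (k has_vector_derivative X) (at 0)}"

text \<open>Ehresmann connections, as connection one-forms. The value at \<open>p\<close> of the fundamental vector
  field of \<open>X\<close> is the velocity of the curve \<open>frame_act (k t) p\<close> for any curve \<open>k\<close> in \<open>G\<close> starting
  at the identity with velocity \<open>X\<close>.\<close>

definition ehresmann_connection ::
  "(real ^ 'n ^ 'n::finite) set \<Rightarrow> (('a, 'n) frame, 'p::euclidean_space) chart set \<Rightarrow>
     (('a, 'n) frame, 'p, real ^ 'n ^ 'n) form \<Rightarrow> bool" where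
  "ehresmann_connection G \<P> \<omega> \<longleftrightarrow>
     smooth_form \<P> 1 \<omega> \<and>
     (\<forall>p\<in>carrier \<P>. \<forall>v\<in>tangent_space \<P> p. \<omega> p [v] \<in> lie_algebra G) \<and>
     (\<forall>k X. (\<forall>t. k t \<in> G) \<and> k 0 = mat 1 \<and> (k has_vector_derivative X) (at 0) \<longrightarrow>
        (\<forall>p\<in>carrier \<P>. \<omega> p [velocity \<P> (\<lambda>t. frame_act (k t) p)] = X)) \<and>
     (\<forall>g\<in>G. \<forall>p\<in>carrier \<P>. \<forall>v\<in>tangent_space \<P> p.
        \<omega> (frame_act g p) [differential \<P> \<P> (frame_act g) p v] = matrix_inv g ** \<omega> p [v] ** g)"

definition soldering_form ::
  "('a, real ^ 'n::finite) chart set \<Rightarrow> (('a, 'n) frame, 'p::euclidean_space) chart set \<Rightarrow>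
     (('a, 'n) frame, 'p, real ^ 'n) form" where
  "soldering_form A \<P> p vs = inv (snd p) (differential \<P> A fst p (hd vs))"

definition torsion ::
  "('a, real ^ 'n::finite) chart set \<Rightarrow> (('a, 'n) frame, 'p::euclidean_space) chart set \<Rightarrow>
     (('a, 'n) frame, 'p, real ^ 'n ^ 'n) form \<Rightarrow> (('a, 'n) frame, 'p, real ^ 'n) form" where
  "torsion A \<P> \<omega> p vs = ext_deriv \<P> (soldering_form A \<P>) p vs +
     wedge (*v) 1 1 \<omega> (soldering_form A \<P>) p vs"

section \<open>The Aristotelian structure group\<close>

text \<open>The block-diagonal matrices \<open>diag(1, A)\<close> with \<open>A\<close> orthogonal.\<close>

definition G_arist :: "(real ^ 'n::_ ^ 'n::{finite, wellorder}) set" where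
  "G_arist = {g. g $ ix0 $ ix0 = 1 \<and> (\<forall>i. i \<noteq> ix0 \<longrightarrow> g $ ix0 $ i = 0 \<and> g $ i $ ix0 = 0) \<and>
     orthogonal_matrix g}"

text \<open>The frames in which \<open>\<tau>, Z, \<gamma>, h\<close> take their standard constant values. These exist at every
  point only if \<open>\<gamma>\<close> and \<open>h\<close> are mutually inverse on the annihilator of \<open>Z\<close> and the kernel of
  \<open>\<tau>\<close>.\<close>

definition aristotelian_frames ::
  "('a, real ^ 'n::{finite, wellorder}) chart set \<Rightarrow>
     ('a, real ^ 'n::_, real) form \<Rightarrow> ('a \<Rightarrow> ('a, real ^ 'n::_) tvec) \<Rightarrow>
     ('a \<Rightarrow> (('a, real ^ 'n::_) tvec \<Rightarrow> real) \<Rightarrow> (('a, real ^ 'n::_) tvec \<Rightarrow> real) \<Rightarrow> real) \<Rightarrow>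
     ('a \<Rightarrow> ('a, real ^ 'n::_) tvec \<Rightarrow> ('a, real ^ 'n::_) tvec \<Rightarrow> real) \<Rightarrow> ('a, 'n) frame set" where
  "aristotelian_frames A \<tau> Z \<gamma> h = {(x, u) \<in> frame_bundle A.
     (\<forall>w. \<tau> x [u w] = w $ ix0) \<and>
     u (axis ix0 1) = Z x \<and>
     (\<forall>\<xi>\<in>cotangent_space A x. \<forall>\<eta>\<in>cotangent_space A x.
        \<gamma> x \<xi> \<eta> = (\<Sum>i\<in>UNIV - {ix0}. \<xi> (u (axis i 1)) * \<eta> (u (axis i 1)))) \<and>
     (\<forall>v w. h x (u v) (u w) = (\<Sum>i\<in>UNIV - {ix0}. v $ i * w $ i))}"

end

(* For a torsion-free connection, the clock component of d\<theta> + \<omega> \<and> \<theta> = 0 reads d(\<pi>^* \<tau>) = 0: the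
   first component of the soldering form is \<pi>^* \<tau>, and the first row of a matrix in the Lie algebra
   is zero. As \<pi> is a submersion (it has local sections), d\<tau> = 0. For an integrable G-structure,
   d\<tau> = 0 because \<tau> is locally the first coordinate differential. In both cases \<tau> \<and> \<alpha> = 0, so
   \<alpha> = f \<tau> with f = \<alpha>(Z), hence d\<alpha> = df \<and> \<tau> and \<alpha> \<and> d\<alpha> = 0 as a form. *)

theory Submission
  imports Defs
begin

section \<open>Calculus in Euclidean space\<close>

text \<open>The obstacle is that \<open>ext_deriv\<close> is a \<open>frechet_derivative\<close>
  taken in a chart picked by \<open>chart_at\<close>, and such a derivative has a meaning only where
  the function is known to be differentiable. Passing from the differential of the pulled back clock
  form to the pullback of its differential requires naturality of the exterior derivative between
  manifolds of different dimension, hence symmetry of second derivatives; chart independence is then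
  the case of the identity map. Similarly, the soldering form is defined pointwise by inverting
  frames, so its differentiability has to be recovered: in coordinates it solves a linear system,
  and Cramer's rule applies. The integrable case is read off in a flat chart; deducing it from the
  torsion statement would take a torsion-free connection on all of \<open>P\<close>, glued from
  local ones.\<close>

lemma frechet_derivative_eqI: "(f has_derivative f') (at x) \<Longrightarrow> frechet_derivative f (at x) = f'"
  by (rule frechet_derivative_at[symmetric])

text \<open>At a point of an open set the derivative depends only on the values inside the set, so
  the equality passes to derivatives and the induction goes through.\<close>

lemma Ck_on_cong:
  assumes "open S" "Ck_on k S f" "\<And>y. y \<in> S \<Longrightarrow> f y = g y"
  shows "Ck_on k S g"
  using assms(2,3)
proof (induction k arbitrary: f g)
  case 0
  then show ?case by (simp add: continuous_on_eq)
next
  case (Suc k)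
  have df: "f differentiable (at y)" if "y \<in> S" for y
    using Suc.prems(1) that \<open>open S\<close> by (simp add: differentiable_on_eq_differentiable_at)
  have D: "frechet_derivative f (at y) = frechet_derivative g (at y)" if "y \<in> S" for y
    by (rule frechet_derivative_transform_within_open[OF df[OF that] \<open>open S\<close> that Suc.prems(2)])
  have "g differentiable_on S"
    using has_derivative_transform_within_open[OF df[unfolded frechet_derivative_works] \<open>open S\<close> _ Suc.prems(2)]
    by (auto simp: differentiable_on_eq_differentiable_at[OF \<open>open S\<close>] differentiable_def)
  moreover have "Ck_on k S (\<lambda>y. frechet_derivative g (at y) w)" for w
  proof (rule Suc.IH)
    show "Ck_on k S (\<lambda>y. frechet_derivative f (at y) w)" using Suc.prems(1) by simp
  qed (rule fun_cong[OF D])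
  ultimately show ?case by simp
qed

lemma Ck_on_bounded_linear:
  assumes "bounded_linear L" "open S" "Ck_on k S f"
  shows "Ck_on k S (\<lambda>y. L (f y))"
  using assms(3)
proof (induction k arbitrary: f)
  case 0
  then show ?case by (simp add: bounded_linear.continuous_on[OF assms(1)])
next
  case (Suc k)
  have d: "((\<lambda>y. L (f y)) has_derivative (\<lambda>w. L (frechet_derivative f (at y) w))) (at y)"
    if "y \<in> S" for y
    using Suc.prems that \<open>open S\<close>
    by (intro bounded_linear.has_derivative[OF assms(1)])
      (simp add: differentiable_on_eq_differentiable_at frechet_derivative_works)
  have "(\<lambda>y. L (f y)) differentiable_on S"
    using d \<open>open S\<close> by (auto simp: differentiable_on_eq_differentiable_at differentiable_def)
  moreover have "Ck_on k S (\<lambda>y. frechet_derivative (\<lambda>y. L (f y)) (at y) w)" for w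
    using Suc.prems d
    by (intro Ck_on_cong[OF \<open>open S\<close> Suc.IH[of "\<lambda>y. frechet_derivative f (at y) w"]])
      (auto simp: frechet_derivative_eqI[OF d])
  ultimately show ?case by simp
qed

text \<open>Applied to \<open>fst\<close> and \<open>snd\<close>, this splits a bundle chart into
  base coordinates and frame matrix.\<close>

lemma smooth_on_bounded_linear:
  "bounded_linear L \<Longrightarrow> open S \<Longrightarrow> smooth_on S f \<Longrightarrow> smooth_on S (\<lambda>y. L (f y))"
  by (simp add: smooth_on_def Ck_on_bounded_linear)

text \<open>The \<open>C^2\<close> part of smoothness, in the form that symmetry of second
  derivatives asks for.\<close>

lemma smooth_on_D:
  assumes "smooth_on S f" "open S" "y \<in> S"
  shows "(f has_derivative frechet_derivative f (at y)) (at y)"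
    and "((\<lambda>y. frechet_derivative f (at y) u) has_derivative
      frechet_derivative (\<lambda>y. frechet_derivative f (at y) u) (at y)) (at y)"
    and "continuous_on S (\<lambda>y. frechet_derivative (\<lambda>y. frechet_derivative f (at y) u) (at y) w)"
  using assms(1)[unfolded smooth_on_def, rule_format, of "Suc (Suc 0)"] assms(2,3)
  by (auto simp: differentiable_on_eq_differentiable_at frechet_derivative_works)

section \<open>Symmetry of second derivatives\<close>

text \<open>The second difference of \<open>f\<close> along a parallelogram, by two applications of the mean value
  theorem.\<close>

lemma second_difference_mvt:
  fixes f :: "'e::real_normed_vector \<Rightarrow> real"
  assumes f': "\<And>y. y \<in> S \<Longrightarrow> (f has_derivative f' y) (at y)"
    and f'': "\<And>y. y \<in> S \<Longrightarrow> ((\<lambda>y. f' y v) has_derivative f'' y) (at y)"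
    and S: "\<And>r s. 0 \<le> r \<Longrightarrow> r \<le> t \<Longrightarrow> 0 \<le> s \<Longrightarrow> s \<le> t \<Longrightarrow> x + r *\<^sub>R v + s *\<^sub>R w \<in> S"
    and t: "0 < t"
  shows "\<exists>r s. 0 < r \<and> r < t \<and> 0 < s \<and> s < t \<and>
    f (x + t *\<^sub>R v + t *\<^sub>R w) - f (x + t *\<^sub>R v) - (f (x + t *\<^sub>R w) - f x)
      = t * (t * f'' (x + r *\<^sub>R v + s *\<^sub>R w) w)"
proof -
  have lin: "linear (f' y)" if "y \<in> S" for y
    using f'[OF that] by (rule has_derivative_linear)
  have lin2: "linear (f'' y)" if "y \<in> S" for y
    using f''[OF that] by (rule has_derivative_linear)
  have 1: "((\<lambda>r. f (x + r *\<^sub>R v + t *\<^sub>R w) - f (x + r *\<^sub>R v)) has_real_derivative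
      f' (x + r *\<^sub>R v + t *\<^sub>R w) v - f' (x + r *\<^sub>R v) v) (at r)"
    if "0 \<le> r" "r \<le> t" for r
  proof -
    have s1: "x + r *\<^sub>R v + t *\<^sub>R w \<in> S" and s2: "x + r *\<^sub>R v \<in> S"
      using S[of r t] S[of r 0] that t by auto
    have "((\<lambda>r. f (x + r *\<^sub>R v + t *\<^sub>R w)) has_derivative (\<lambda>h. f' (x + r *\<^sub>R v + t *\<^sub>R w) (h *\<^sub>R v))) (at r)"
      by (rule has_derivative_compose[where f = "\<lambda>r. x + r *\<^sub>R v + t *\<^sub>R w", OF _ f'[OF s1]])
        (auto intro!: derivative_eq_intros)
    moreover have "((\<lambda>r. f (x + r *\<^sub>R v)) has_derivative (\<lambda>h. f' (x + r *\<^sub>R v) (h *\<^sub>R v))) (at r)"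
      by (rule has_derivative_compose[where f = "\<lambda>r. x + r *\<^sub>R v", OF _ f'[OF s2]])
        (auto intro!: derivative_eq_intros)
    ultimately show ?thesis
      unfolding has_field_derivative_def
      by (auto intro!: derivative_eq_intros
          simp: linear_scale[OF lin[OF s1]] linear_scale[OF lin[OF s2]] left_diff_distrib mult.commute right_diff_distrib fun_eq_iff)
  qed
  obtain r where r: "0 < r" "r < t" and r_eq:
    "f (x + t *\<^sub>R v + t *\<^sub>R w) - f (x + t *\<^sub>R v) - (f (x + 0 *\<^sub>R v + t *\<^sub>R w) - f (x + 0 *\<^sub>R v))
      = (t - 0) * (f' (x + r *\<^sub>R v + t *\<^sub>R w) v - f' (x + r *\<^sub>R v) v)"
    using MVT2[OF t 1] by blast
  have 2: "((\<lambda>s. f' (x + r *\<^sub>R v + s *\<^sub>R w) v) has_real_derivative f'' (x + r *\<^sub>R v + s *\<^sub>R w) w) (at s)"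
    if "0 \<le> s" "s \<le> t" for s
  proof -
    have s1: "x + r *\<^sub>R v + s *\<^sub>R w \<in> S" using S[of r s] that r by auto
    have "((\<lambda>s. f' (x + r *\<^sub>R v + s *\<^sub>R w) v) has_derivative (\<lambda>h. f'' (x + r *\<^sub>R v + s *\<^sub>R w) (h *\<^sub>R w))) (at s)"
      by (rule has_derivative_compose[where f = "\<lambda>s. x + r *\<^sub>R v + s *\<^sub>R w", OF _ f''[OF s1]])
        (auto intro!: derivative_eq_intros)
    then show ?thesis
      unfolding has_field_derivative_def
      by (rule has_derivative_eq_rhs) (simp add: fun_eq_iff linear_scale[OF lin2[OF s1]] mult.commute)
  qed
  obtain s where s: "0 < s" "s < t" and s_eq:
    "f' (x + r *\<^sub>R v + t *\<^sub>R w) v - f' (x + r *\<^sub>R v + 0 *\<^sub>R w) v = (t - 0) * f'' (x + r *\<^sub>R v + s *\<^sub>R w) w"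
    using MVT2[OF t 2] by blast
  show ?thesis
    using r s r_eq s_eq by (intro exI[of _ r] exI[of _ s]) auto
qed

text \<open>The second difference over a parallelogram does not see the order of its two sides.
  Evaluating it by the mean value theorem in both orders gives two points near \<open>x\<close>
  where the two mixed derivatives agree; shrinking the parallelogram moves both points to
  \<open>x\<close>, and continuity finishes.\<close>

lemma second_derivative_symmetric_real:
  fixes f :: "'e::real_normed_vector \<Rightarrow> real"
  assumes "open S" "x \<in> S"
    and f': "\<And>y. y \<in> S \<Longrightarrow> (f has_derivative f' y) (at y)"
    and f'': "\<And>y u. y \<in> S \<Longrightarrow> ((\<lambda>y. f' y u) has_derivative f'' u y) (at y)"
    and cont: "\<And>u z. continuous_on S (\<lambda>y. f'' u y z)"
  shows "f'' v x w = f'' w x v"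
proof -
  obtain e where e: "0 < e" "ball x e \<subseteq> S"
    using \<open>open S\<close> \<open>x \<in> S\<close> openE by blast
  \<comment> \<open>The first factor keeps the parallelogram in the ball, where \<open>+ 1\<close>
    makes the bound strict and covers \<open>v = w = 0\<close>; the second factor lets the
    parallelogram shrink to \<open>x\<close>.\<close>
  define t where "t n = e / (norm v + norm w + 1) * inverse (real (Suc n))" for n
  have K: "0 < norm v + norm w + 1" by (simp add: add_nonneg_pos)
  have t0: "0 < t n" for n using e(1) K by (simp add: t_def)
  \<comment> \<open>The bound sees the directions only through the sum of their norms, so it serves
    the order \<open>v\<close>, \<open>w\<close> as well as \<open>w\<close>,
    \<open>v\<close>.\<close>
  have near: "dist x (x + r *\<^sub>R a + s *\<^sub>R b) \<le> t n * (norm v + norm w)"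
    if "\<bar>r\<bar> \<le> t n" "\<bar>s\<bar> \<le> t n" "norm a + norm b = norm v + norm w" for r s n a b
  proof -
    have "dist x (x + r *\<^sub>R a + s *\<^sub>R b) \<le> \<bar>r\<bar> * norm a + \<bar>s\<bar> * norm b"
      using norm_triangle_ineq[of "r *\<^sub>R a" "s *\<^sub>R b"]
      by (metis add.assoc add_diff_cancel_left' dist_commute dist_norm norm_scaleR)
    also have "\<dots> \<le> t n * norm a + t n * norm b"
      using that by (intro add_mono mult_right_mono) auto
    finally show ?thesis by (simp add: that(3) distrib_left[symmetric])
  qed
  have small: "t n * (norm v + norm w) < e" for n
  proof -
    have "t n * (norm v + norm w) \<le> e / (norm v + norm w + 1) * 1 * (norm v + norm w)"
      unfolding t_def using e(1) K by (intro mult_right_mono mult_left_mono) (auto simp: field_simps)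
    also have "\<dots> < e" using e(1) K by (simp add: field_simps)
    finally show ?thesis .
  qed
  have inS: "x + r *\<^sub>R a + s *\<^sub>R b \<in> S"
    if "0 \<le> r" "r \<le> t n" "0 \<le> s" "s \<le> t n" "norm a + norm b = norm v + norm w" for r s n a b
    using near[of r n s a b] small[of n] that e(2) by (auto simp: subset_iff)
  have ex: "\<exists>q q'. dist x q \<le> t n * (norm v + norm w) \<and> dist x q' \<le> t n * (norm v + norm w) \<and>
      f'' v q w = f'' w q' v" for n
  proof -
    obtain r s where 1: "0 < r" "r < t n" "0 < s" "s < t n"
      "f (x + t n *\<^sub>R v + t n *\<^sub>R w) - f (x + t n *\<^sub>R v) - (f (x + t n *\<^sub>R w) - f x)
        = t n * (t n * f'' v (x + r *\<^sub>R v + s *\<^sub>R w) w)"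
      using second_difference_mvt[where f = f and S = S and t = "t n" and x = x and v = v and w = w, OF f' f'' inS[of _ n] t0]
      by auto
    obtain r' s' where 2: "0 < r'" "r' < t n" "0 < s'" "s' < t n"
      "f (x + t n *\<^sub>R w + t n *\<^sub>R v) - f (x + t n *\<^sub>R w) - (f (x + t n *\<^sub>R v) - f x)
        = t n * (t n * f'' w (x + r' *\<^sub>R w + s' *\<^sub>R v) v)"
      using second_difference_mvt[where f = f and S = S and t = "t n" and x = x and v = w and w = v, OF f' f'' inS[of _ n] t0]
      by (auto simp: add.commute)
    have sw: "x + t n *\<^sub>R w + t n *\<^sub>R v = x + t n *\<^sub>R v + t n *\<^sub>R w" by simp
    have "t n * (t n * f'' v (x + r *\<^sub>R v + s *\<^sub>R w) w) = t n * (t n * f'' w (x + r' *\<^sub>R w + s' *\<^sub>R v) v)"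
      using 1(5) 2(5) unfolding sw by linarith
    then have "f'' v (x + r *\<^sub>R v + s *\<^sub>R w) w = f'' w (x + r' *\<^sub>R w + s' *\<^sub>R v) v"
      using t0[of n] by (metis less_numeral_extra(3) mult_left_cancel)
    moreover have "dist x (x + r *\<^sub>R v + s *\<^sub>R w) \<le> t n * (norm v + norm w)"
      using 1 by (intro near) auto
    moreover have "dist x (x + r' *\<^sub>R w + s' *\<^sub>R v) \<le> t n * (norm v + norm w)"
      using 2 by (intro near) auto
    ultimately show ?thesis by blast
  qed
  obtain q q' where near_q: "\<And>n. dist x (q n) \<le> t n * (norm v + norm w)"
    and near_q': "\<And>n. dist x (q' n) \<le> t n * (norm v + norm w)"
    and eq: "\<And>n. f'' v (q n) w = f'' w (q' n) v"
    using ex by metis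
  have t_lim: "(\<lambda>n. t n * (norm v + norm w)) \<longlonglongrightarrow> 0"
    unfolding t_def by (intro tendsto_mult_left_zero tendsto_mult_right_zero LIMSEQ_inverse_real_of_nat)
  have lim: "p \<longlonglongrightarrow> x" if "\<And>n. dist x (p n) \<le> t n * (norm v + norm w)" for p
    unfolding tendsto_dist_iff[of p]
    by (rule Lim_null_comparison[OF _ t_lim]) (simp add: that dist_commute[of _ x])
  have c: "isCont (\<lambda>y. f'' u y z) x" for u z
    using cont \<open>open S\<close> \<open>x \<in> S\<close> by (simp add: continuous_on_eq_continuous_at)
  have "(\<lambda>n. f'' v (q n) w) \<longlonglongrightarrow> f'' v x w"
    by (rule isCont_tendsto_compose[OF c lim[OF near_q]])
  moreover have "(\<lambda>n. f'' w (q' n) v) \<longlonglongrightarrow> f'' w x v"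
    by (rule isCont_tendsto_compose[OF c lim[OF near_q']])
  ultimately show ?thesis using eq LIMSEQ_unique by auto
qed

text \<open>The mean value theorem is real-valued, hence the reduction to the components along basis
  vectors.\<close>

lemma second_derivative_symmetric:
  fixes f :: "'e::euclidean_space \<Rightarrow> 'f::euclidean_space"
  assumes "smooth_on S f" "open S" "x \<in> S"
  shows "frechet_derivative (\<lambda>y. frechet_derivative f (at y) v) (at x) w
    = frechet_derivative (\<lambda>y. frechet_derivative f (at y) w) (at x) v"
proof (rule euclidean_eqI)
  fix b :: 'f
  show "frechet_derivative (\<lambda>y. frechet_derivative f (at y) v) (at x) w \<bullet> b
    = frechet_derivative (\<lambda>y. frechet_derivative f (at y) w) (at x) v \<bullet> b"
    by (rule second_derivative_symmetric_real[OF assms(2,3), where f = "\<lambda>y. f y \<bullet> b"])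
      (auto intro!: has_derivative_inner_left smooth_on_D[OF assms(1,2)] continuous_intros assms(3))
qed

section \<open>Pullback of one-forms in coordinates\<close>

text \<open>The first term comes from moving the base point, the second from the moving argument.
  Differentiability of \<open>t\<close> is given for each fixed argument, so the argument is
  expanded in the basis before the product rule is applied.\<close>

lemma pullback_one_form_has_derivative:
  fixes g :: "'p::euclidean_space \<Rightarrow> 'e::euclidean_space" and t :: "'e \<Rightarrow> 'e \<Rightarrow> real"
  assumes g: "smooth_on S g" "open S" "a \<in> S"
    and lin: "\<And>y. y \<in> S \<Longrightarrow> linear (t (g y))"
    and t: "\<And>w. (\<lambda>z. t z w) differentiable (at (g a))"
  shows "((\<lambda>y. t (g y) (frechet_derivative g (at y) w)) has_derivative
    (\<lambda>v. frechet_derivative (\<lambda>z. t z (frechet_derivative g (at a) w)) (at (g a)) (frechet_derivative g (at a) v)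
      + t (g a) (frechet_derivative (\<lambda>y. frechet_derivative g (at y) w) (at a) v))) (at a)"
proof -
  let ?D = "\<lambda>y. frechet_derivative g (at y)"
  note d = smooth_on_D[OF g]
  have expand: "t z u = (\<Sum>b\<in>Basis. (u \<bullet> b) * t z b)" if "linear (t z)" for z u
    by (subst euclidean_representation[of u, symmetric])
      (simp only: linear_sum[OF that] linear_scale[OF that] real_scaleR_def)
  have t': "((\<lambda>z. t z u) has_derivative frechet_derivative (\<lambda>z. t z u) (at (g a))) (at (g a))" for u
    using t by (simp add: frechet_derivative_works)
  have tg: "((\<lambda>y. t (g y) u) has_derivative (\<lambda>v. frechet_derivative (\<lambda>z. t z u) (at (g a)) (?D a v))) (at a)" for u
    using has_derivative_compose[OF d(1) t'] by simp
  have sum_D: "(\<Sum>b\<in>Basis. (u \<bullet> b) * frechet_derivative (\<lambda>z. t z b) (at (g a)) (?D a v))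
      = frechet_derivative (\<lambda>z. t z u) (at (g a)) (?D a v)" for u v
  proof -
    have "((\<lambda>y. t (g y) u) has_derivative
        (\<lambda>v. \<Sum>b\<in>Basis. (u \<bullet> b) * frechet_derivative (\<lambda>z. t z b) (at (g a)) (?D a v))) (at a)"
      by (rule has_derivative_transform_within_open[OF _ g(2,3), where f = "\<lambda>y. \<Sum>b\<in>Basis. (u \<bullet> b) * t (g y) b"])
        (auto intro!: has_derivative_sum has_derivative_mult_right tg expand[OF lin, symmetric])
    then show ?thesis using fun_cong[OF has_derivative_unique[OF _ tg]] by blast
  qed
  have *: "((\<lambda>y. \<Sum>b\<in>Basis. (?D y w \<bullet> b) * t (g y) b) has_derivative
      (\<lambda>v. \<Sum>b\<in>Basis. (?D a w \<bullet> b) * frechet_derivative (\<lambda>z. t z b) (at (g a)) (?D a v)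
        + (frechet_derivative (\<lambda>y. ?D y w) (at a) v \<bullet> b) * t (g a) b)) (at a)"
    by (intro has_derivative_sum has_derivative_mult has_derivative_inner_left d tg)
  have "((\<lambda>y. t (g y) (?D y w)) has_derivative
      (\<lambda>v. \<Sum>b\<in>Basis. (?D a w \<bullet> b) * frechet_derivative (\<lambda>z. t z b) (at (g a)) (?D a v)
        + (frechet_derivative (\<lambda>y. ?D y w) (at a) v \<bullet> b) * t (g a) b)) (at a)"
    by (rule has_derivative_transform_within_open[OF * g(2,3)]) (rule expand[OF lin, symmetric])
  then show ?thesis
    by (simp add: sum.distrib sum_D expand[OF lin[OF g(3)], symmetric])
qed

text \<open>The term with the second derivative of \<open>g\<close> is symmetric in \<open>v\<close>
  and \<open>w\<close> and cancels on antisymmetrising. The function \<open>s\<close> stands for the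
  pulled back form, which agrees with the explicit formula only on \<open>S\<close>.\<close>

lemma pullback_one_form_ext_deriv:
  fixes g :: "'p::euclidean_space \<Rightarrow> 'e::euclidean_space" and t :: "'e \<Rightarrow> 'e \<Rightarrow> real"
  assumes g: "smooth_on S g" "open S" "a \<in> S"
    and lin: "\<And>y. y \<in> S \<Longrightarrow> linear (t (g y))"
    and t: "\<And>w. (\<lambda>z. t z w) differentiable (at (g a))"
    and s: "\<And>y w. y \<in> S \<Longrightarrow> s y w = t (g y) (frechet_derivative g (at y) w)"
  shows "frechet_derivative (\<lambda>y. s y w) (at a) v - frechet_derivative (\<lambda>y. s y v) (at a) w
    = frechet_derivative (\<lambda>z. t z (frechet_derivative g (at a) w)) (at (g a)) (frechet_derivative g (at a) v)
      - frechet_derivative (\<lambda>z. t z (frechet_derivative g (at a) v)) (at (g a)) (frechet_derivative g (at a) w)"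
proof -
  have d: "((\<lambda>y. s y w) has_derivative
    (\<lambda>v. frechet_derivative (\<lambda>z. t z (frechet_derivative g (at a) w)) (at (g a)) (frechet_derivative g (at a) v)
      + t (g a) (frechet_derivative (\<lambda>y. frechet_derivative g (at y) w) (at a) v))) (at a)" for w
    by (rule has_derivative_transform_within_open[OF pullback_one_form_has_derivative[OF g lin t] g(2,3)])
      (simp_all add: s)
  then show ?thesis
    using second_derivative_symmetric[OF g, of v w] by (simp add: frechet_derivative_eqI[OF d])
qed

section \<open>Linear systems depending on a parameter\<close>

lemma det_differentiable:
  fixes M :: "'p::real_normed_vector \<Rightarrow> real ^ 'n::finite ^ 'n"
  assumes "\<And>i j. (\<lambda>y. M y $ i $ j) differentiable (at a)"
  shows "(\<lambda>y. det (M y)) differentiable (at a)"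
proof -
  let ?D = "\<lambda>i j. frechet_derivative (\<lambda>y. M y $ i $ j) (at a)"
  have "((\<lambda>y. M y $ i $ j) has_derivative ?D i j) (at a)" for i j
    using assms frechet_derivative_works by blast
  then have "((\<lambda>y. det (M y)) has_derivative (\<lambda>h. \<Sum>p | p permutes UNIV.
      of_int (sign p) * (\<Sum>i\<in>UNIV. ?D i (p i) h * (\<Prod>j\<in>UNIV - {i}. M a $ j $ p j)))) (at a)"
    unfolding det_def by (intro has_derivative_sum has_derivative_mult_right has_derivative_prod)
  then show ?thesis by (rule differentiableI)
qed

text \<open>Cramer's rule: each component of the solution is a quotient of two differentiable
  determinants. Nothing is assumed about the regularity of \<open>x\<close> itself, which makes the
  lemma fit a pointwise defined solution.\<close>

lemma solve_linear_system_differentiable: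
  fixes M :: "'p::real_normed_vector \<Rightarrow> real ^ 'n::finite ^ 'n" and b x :: "'p \<Rightarrow> real ^ 'n"
  assumes "open S" "a \<in> S"
    and M: "\<And>i j. (\<lambda>y. M y $ i $ j) differentiable (at a)"
    and b: "\<And>i. (\<lambda>y. b y $ i) differentiable (at a)"
    and x: "\<And>y. y \<in> S \<Longrightarrow> det (M y) \<noteq> 0 \<and> M y *v x y = b y"
  shows "x differentiable (at a)"
proof -
  \<comment> \<open>The coefficient matrix with column \<open>k\<close> replaced by the right-hand
    side.\<close>
  let ?N = "\<lambda>k y. \<chi> i j. if j = k then b y $ i else M y $ i $ j"
  have N: "(\<lambda>y. det (?N k y)) differentiable (at a)" for k
  proof (rule det_differentiable)
    show "(\<lambda>y. ?N k y $ i $ j) differentiable (at a)" for i j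
      by (cases "j = k") (simp_all add: M b)
  qed
  note d = det_differentiable[of M a, OF M] N
  have "(\<lambda>y. x y $ k) differentiable (at a)" for k
  proof -
    have "(\<lambda>y. det (?N k y) / det (M y)) differentiable (at a)"
      by (rule differentiableI[OF has_derivative_divide'])
        (use d x[OF assms(2)] frechet_derivative_works in auto)
    then obtain D where "((\<lambda>y. det (?N k y) / det (M y)) has_derivative D) (at a)"
      by (auto simp: differentiable_def)
    then have "((\<lambda>y. x y $ k) has_derivative D) (at a)"
    proof (rule has_derivative_transform_within_open[OF _ assms(1,2)])
      fix y assume y: "y \<in> S"
      have "x y = (\<chi> k. det (?N k y) / det (M y))"
        using cramer[of "M y" "x y" "b y"] x[OF y] by simp
      then show "det (?N k y) / det (M y) = x y $ k" by simp
    qed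
    then show ?thesis by (rule differentiableI)
  qed
  then show ?thesis
    unfolding differentiable_componentwise_within[of x] by (auto simp: Basis_vec_def inner_axis)
qed

section \<open>Charts, tangent vectors and the manifold topology\<close>

lemma chart_inv_left: "smooth_atlas A \<Longrightarrow> c \<in> A \<Longrightarrow> x \<in> fst c \<Longrightarrow> chart_inv c (snd c x) = x"
  by (simp add: smooth_atlas_def is_chart_def)

lemma chart_at:
  assumes "x \<in> carrier A"
  shows "chart_at A x \<in> A" "x \<in> fst (chart_at A x)"
proof -
  have "\<exists>c. c \<in> A \<and> x \<in> fst c" using assms by (auto simp: carrier_def simp del: split_paired_Ex)
  from someI_ex[OF this] show "chart_at A x \<in> A" "x \<in> fst (chart_at A x)"
    by (simp_all add: chart_at_def)
qed

lemma in_carrier: "c \<in> A \<Longrightarrow> x \<in> fst c \<Longrightarrow> x \<in> carrier A"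
  by (auto simp: carrier_def)

lemma tangent_space_change_chart:
  assumes "v \<in> tangent_space A x" "c \<in> A" "d \<in> A" "x \<in> fst c" "x \<in> fst d"
  shows "frechet_derivative (snd d \<circ> chart_inv c) (at (snd c x)) (v c) = v d"
  using conjunct1[OF CollectD[OF assms(1)[unfolded tangent_space_def]], rule_format, OF assms(2,3)] assms(4,5)
  by simp

lemma tangent_space_outside:
  "v \<in> tangent_space A x \<Longrightarrow> \<not> (c \<in> A \<and> x \<in> fst c) \<Longrightarrow> v c = 0"
  unfolding tangent_space_def by blast

lemma tangent_spaceI:
  assumes "\<And>c d. c \<in> A \<Longrightarrow> d \<in> A \<Longrightarrow> x \<in> fst c \<Longrightarrow> x \<in> fst d \<Longrightarrow>
      v d = frechet_derivative (snd d \<circ> chart_inv c) (at (snd c x)) (v c)"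
    and "\<And>c. \<not> (c \<in> A \<and> x \<in> fst c) \<Longrightarrow> v c = 0"
  shows "v \<in> tangent_space A x"
  unfolding tangent_space_def using assms by blast

text \<open>Unlike in \<open>smooth_map_on\<close>, openness of the coordinate domains is built in,
  so derivatives of coordinate expressions can be taken without returning to the topologies. It is
  used for the identity, where it expresses chart changes, and for the bundle projection.\<close>

definition smooth_in_charts ::
  "('b, 'p::euclidean_space) chart set \<Rightarrow> ('a, 'e::euclidean_space) chart set \<Rightarrow> ('b \<Rightarrow> 'a) \<Rightarrow> bool" where
  "smooth_in_charts B A f \<longleftrightarrow> f ` carrier B \<subseteq> carrier A \<and>
     (\<forall>c\<in>B. \<forall>d\<in>A. open (snd c ` (fst c \<inter> f -` fst d)) \<and>
        smooth_on (snd c ` (fst c \<inter> f -` fst d)) (snd d \<circ> f \<circ> chart_inv c))"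

lemma smooth_in_charts_id: "smooth_atlas A \<Longrightarrow> smooth_in_charts A A id"
  by (auto simp: smooth_in_charts_def smooth_atlas_def compatible_def)

lemma smooth_in_charts_D:
  assumes "smooth_in_charts B A f" "c \<in> B" "p \<in> fst c" "d \<in> A" "f p \<in> fst d"
  shows "open (snd c ` (fst c \<inter> f -` fst d))"
    and "smooth_on (snd c ` (fst c \<inter> f -` fst d)) (snd d \<circ> f \<circ> chart_inv c)"
    and "snd c p \<in> snd c ` (fst c \<inter> f -` fst d)"
    and "((snd d \<circ> f \<circ> chart_inv c) has_derivative
      frechet_derivative (snd d \<circ> f \<circ> chart_inv c) (at (snd c p))) (at (snd c p))"
proof -
  show 1: "open (snd c ` (fst c \<inter> f -` fst d))"
    and 2: "smooth_on (snd c ` (fst c \<inter> f -` fst d)) (snd d \<circ> f \<circ> chart_inv c)"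
    using assms by (auto simp: smooth_in_charts_def)
  show 3: "snd c p \<in> snd c ` (fst c \<inter> f -` fst d)" using assms by auto
  show "((snd d \<circ> f \<circ> chart_inv c) has_derivative
      frechet_derivative (snd d \<circ> f \<circ> chart_inv c) (at (snd c p))) (at (snd c p))"
    by (rule smooth_on_D(1)[OF 2 1 3])
qed

lemma transition_has_derivative:
  assumes "smooth_atlas A" "c \<in> A" "d \<in> A" "x \<in> fst c" "x \<in> fst d"
  shows "((snd d \<circ> chart_inv c) has_derivative
    frechet_derivative (snd d \<circ> chart_inv c) (at (snd c x))) (at (snd c x))"
  using smooth_in_charts_D(4)[OF smooth_in_charts_id[OF assms(1)], of c x d] assms by simp

text \<open>The chain rule through the transition map, valid on the overlap of the two chart
  domains. With \<open>g\<close> another coordinate map it gives the cocycle rule for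
  Jacobians.\<close>

lemma change_chart_has_derivative:
  assumes "smooth_atlas A" "c \<in> A" "d \<in> A" "x \<in> fst c" "x \<in> fst d"
    and "((g \<circ> chart_inv d) has_derivative g') (at (snd d x))"
  shows "((g \<circ> chart_inv c) has_derivative
    (\<lambda>w. g' (frechet_derivative (snd d \<circ> chart_inv c) (at (snd c x)) w))) (at (snd c x))"
proof (rule has_derivative_transform_within_open)
  note D = smooth_in_charts_D[OF smooth_in_charts_id[OF assms(1)] assms(2,4,3), simplified, OF assms(5)]
  have "(snd d \<circ> chart_inv c) (snd c x) = snd d x"
    by (simp add: chart_inv_left[OF assms(1,2,4)])
  with assms(6) show "((\<lambda>y. (g \<circ> chart_inv d) ((snd d \<circ> chart_inv c) y)) has_derivative
    (\<lambda>w. g' (frechet_derivative (snd d \<circ> chart_inv c) (at (snd c x)) w))) (at (snd c x))"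
    by (intro has_derivative_compose[OF transition_has_derivative[OF assms(1-5)]]) (simp only:)
  show "open (snd c ` (fst c \<inter> fst d))" using D(1) by simp
  show "snd c x \<in> snd c ` (fst c \<inter> fst d)" using assms by blast
  show "(g \<circ> chart_inv d) ((snd d \<circ> chart_inv c) y) = (g \<circ> chart_inv c) y"
    if "y \<in> snd c ` (fst c \<inter> fst d)" for y
    using that by (auto simp: chart_inv_left[OF assms(1)] assms)
qed

lemma coord_vec_same:
  assumes "smooth_atlas A" "c \<in> A" "x \<in> fst c"
  shows "coord_vec A c x w c = w"
proof -
  have "((snd c \<circ> chart_inv c) has_derivative (\<lambda>w. w)) (at (snd c x))"
  proof (rule has_derivative_transform_within_open[OF has_derivative_ident])
    show "open (snd c ` fst c)" using assms by (auto simp: smooth_atlas_def is_chart_def)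
    show "snd c x \<in> snd c ` fst c" using assms by simp
  qed (auto simp: chart_inv_left[OF assms(1,2)])
  then show ?thesis
    using assms by (simp add: coord_vec_def frechet_derivative_eqI)
qed

lemma coord_vec_in_tangent_space:
  assumes "smooth_atlas A" "c \<in> A" "x \<in> fst c"
  shows "coord_vec A c x w \<in> tangent_space A x"
proof -
  have *: "frechet_derivative (snd e \<circ> chart_inv c) (at (snd c x)) w =
      frechet_derivative (snd e \<circ> chart_inv d) (at (snd d x))
        (frechet_derivative (snd d \<circ> chart_inv c) (at (snd c x)) w)"
    if "d \<in> A" "e \<in> A" "x \<in> fst d" "x \<in> fst e" for d e
    by (rule frechet_derivative_eqI[OF change_chart_has_derivative[OF assms(1,2) that(1) assms(3) that(3)], THEN fun_cong])
      (rule transition_has_derivative[OF assms(1) that])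
  show ?thesis
  proof (rule tangent_spaceI)
    fix d e assume "d \<in> A" "e \<in> A" "x \<in> fst d" "x \<in> fst e"
    then show "coord_vec A c x w e =
        frechet_derivative (snd e \<circ> chart_inv d) (at (snd d x)) (coord_vec A c x w d)"
      using *[of d e] by (simp add: coord_vec_def)
  qed (auto simp: coord_vec_def)
qed

text \<open>Equality of tangent vectors can thereby be tested in a single chart around
  \<open>x\<close>; in charts away from \<open>x\<close> both sides are zero by convention.\<close>

lemma tangent_space_coord_vec:
  assumes "v \<in> tangent_space A x" "c \<in> A" "x \<in> fst c"
  shows "coord_vec A c x (v c) = v"
proof
  show "coord_vec A c x (v c) d = v d" for d
    using assms by (cases "d \<in> A \<and> x \<in> fst d")
      (auto simp: coord_vec_def tangent_space_change_chart tangent_space_outside)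
qed

lemma coord_vec_lincomb:
  assumes "smooth_atlas A" "c \<in> A" "x \<in> fst c"
  shows "coord_vec A c x (a *\<^sub>R v + b *\<^sub>R w) = lincomb a (coord_vec A c x v) b (coord_vec A c x w)"
proof
  fix d
  have "linear (frechet_derivative (snd d \<circ> chart_inv c) (at (snd c x)))" if "d \<in> A" "x \<in> fst d"
    by (rule has_derivative_linear[OF transition_has_derivative]) (use assms that in auto)
  then show "coord_vec A c x (a *\<^sub>R v + b *\<^sub>R w) d = lincomb a (coord_vec A c x v) b (coord_vec A c x w) d"
    by (simp add: coord_vec_def lincomb_def linear_add linear_scale)
qed

text \<open>\<open>differential\<close> is computed in the arbitrary chart
  \<open>chart_at B p\<close>; by the chain rule any other chart around \<open>p\<close> gives the
  same vector.\<close>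

lemma differential_in_chart:
  assumes "smooth_atlas B" "smooth_in_charts B A f" "c \<in> B" "p \<in> fst c" "d \<in> A" "f p \<in> fst d"
    and "v \<in> tangent_space B p"
  shows "differential B A f p v d = frechet_derivative (snd d \<circ> f \<circ> chart_inv c) (at (snd c p)) (v c)"
proof -
  define c' where "c' = chart_at B p"
  have c': "c' \<in> B" "p \<in> fst c'"
    using chart_at[OF in_carrier[OF assms(3,4)]] by (auto simp: c'_def)
  have "v c' = frechet_derivative (snd c' \<circ> chart_inv c) (at (snd c p)) (v c)"
    by (rule tangent_space_change_chart[symmetric]) (use assms c' in auto)
  moreover have "frechet_derivative (snd d \<circ> f \<circ> chart_inv c) (at (snd c p)) (v c) =
      frechet_derivative (snd d \<circ> f \<circ> chart_inv c') (at (snd c' p))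
        (frechet_derivative (snd c' \<circ> chart_inv c) (at (snd c p)) (v c))"
    by (rule frechet_derivative_eqI[OF change_chart_has_derivative[OF assms(1,3) c'(1) assms(4) c'(2)], THEN fun_cong])
      (rule smooth_in_charts_D(4)[OF assms(2) c' assms(5,6)])
  ultimately show ?thesis
    using assms by (simp add: differential_def c'_def Let_def)
qed

lemma differential_in_tangent_space:
  assumes B: "smooth_atlas B" and A: "smooth_atlas A" and f: "smooth_in_charts B A f"
    and p: "p \<in> carrier B" and v: "v \<in> tangent_space B p"
  shows "differential B A f p v \<in> tangent_space A (f p)"
proof -
  obtain c where c: "c \<in> B" "p \<in> fst c" using p by (auto simp: carrier_def)
  have "differential B A f p v e =
      frechet_derivative (snd e \<circ> chart_inv d) (at (snd d (f p))) (differential B A f p v d)"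
    if d: "d \<in> A" "f p \<in> fst d" and e: "e \<in> A" "f p \<in> fst e" for d e
  proof -
    note D = smooth_in_charts_D[OF f c d]
    have pt: "(snd d \<circ> f \<circ> chart_inv c) (snd c p) = snd d (f p)"
      by (simp add: chart_inv_left[OF B c])
    have "((snd e \<circ> f \<circ> chart_inv c) has_derivative
        (\<lambda>w. frechet_derivative (snd e \<circ> chart_inv d) (at (snd d (f p)))
          (frechet_derivative (snd d \<circ> f \<circ> chart_inv c) (at (snd c p)) w))) (at (snd c p))"
    proof (rule has_derivative_transform_within_open[OF _ D(1,3)])
      show "((\<lambda>y. (snd e \<circ> chart_inv d) ((snd d \<circ> f \<circ> chart_inv c) y)) has_derivative
        (\<lambda>w. frechet_derivative (snd e \<circ> chart_inv d) (at (snd d (f p)))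
          (frechet_derivative (snd d \<circ> f \<circ> chart_inv c) (at (snd c p)) w))) (at (snd c p))"
        by (rule has_derivative_compose[OF D(4)], unfold pt)
          (rule transition_has_derivative[OF A d(1) e(1) d(2) e(2)])
    qed (auto simp: chart_inv_left[OF B c(1)] chart_inv_left[OF A d(1)])
    then show ?thesis
      by (simp add: differential_in_chart[OF B f c d v] differential_in_chart[OF B f c e v] frechet_derivative_eqI)
  qed
  then show ?thesis
    by (intro tangent_spaceI) (blast, auto simp: differential_def)
qed

lemma differential_id:
  assumes "smooth_atlas A" "x \<in> carrier A" "v \<in> tangent_space A x"
  shows "differential A A id x v = v"
proof
  fix d
  show "differential A A id x v d = v d"
  proof (cases "d \<in> A \<and> x \<in> fst d")
    case True
    obtain c where c: "c \<in> A" "x \<in> fst c" using assms(2) by (auto simp: carrier_def)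
    then have "differential A A id x v d = frechet_derivative (snd d \<circ> chart_inv c) (at (snd c x)) (v c)"
      using differential_in_chart[OF assms(1) smooth_in_charts_id[OF assms(1)] c, of d v] True assms by simp
    then show ?thesis using assms(3) True c by (simp add: tangent_space_change_chart)
  next
    case False
    then show ?thesis using assms(3) by (auto simp: tangent_space_outside differential_def)
  qed
qed

section \<open>The topology of an atlas\<close>

text \<open>Images commute with intersections under injective maps, which is all that a topology of
  atlas-open sets requires. In this form the result applies to \<open>frame_atlas A\<close> without
  checking that the bundle charts are smoothly compatible.\<close>

lemma openin_manifold_topology_inj:
  assumes inj: "\<And>c. c \<in> A \<Longrightarrow> inj_on (snd c) (fst c)"
  shows "openin (manifold_topology A) = atlas_open A"
proof -
  have "snd c ` (S \<inter> T \<inter> fst c) = snd c ` (S \<inter> fst c) \<inter> snd c ` (T \<inter> fst c)" if "c \<in> A" for c S T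
    using inj[OF that] by (auto simp: inj_on_def)
  moreover have "open (snd c ` (\<Union>K \<inter> fst c))" 
    if "\<forall>S\<in>K. S \<subseteq> carrier A \<and> (\<forall>c\<in>A. open (snd c ` (S \<inter> fst c)))" "c \<in> A" for K c
  proof -
    have "snd c ` (\<Union>K \<inter> fst c) = (\<Union>S\<in>K. snd c ` (S \<inter> fst c))" by blast
    with that show ?thesis by auto
  qed
  ultimately have "istopology (atlas_open A)"
    by (auto simp: istopology_def atlas_open_def open_Int)
  then show ?thesis
    by (simp add: manifold_topology_def topology_inverse')
qed

lemma openin_chart_domain:
  assumes "smooth_atlas A" "c \<in> A"
  shows "openin (manifold_topology A) (fst c)"
  using assms unfolding openin_manifold_topology[OF assms(1)] atlas_open_def
  by (auto simp: smooth_atlas_def compatible_def carrier_def)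

lemma topspace_manifold_topology:
  assumes "smooth_atlas A"
  shows "topspace (manifold_topology A) = carrier A"
proof
  show "topspace (manifold_topology A) \<subseteq> carrier A"
    using openin_topspace[of "manifold_topology A"]
    unfolding openin_manifold_topology[OF assms] by (simp add: atlas_open_def)
  show "carrier A \<subseteq> topspace (manifold_topology A)"
    using openin_subset[OF openin_chart_domain[OF assms]] by (auto simp: carrier_def)
qed

text \<open>Turns the continuity in \<open>smooth_map_on\<close> into openness of coordinate
  domains. It is applied to the embedding of a \<open>G\<close>-structure in the frame bundle and to
  local sections.\<close>

lemma open_chart_image_preimage:
  assumes B: "smooth_atlas B" and f: "smooth_map_on B A U f" and U: "openin (manifold_topology B) U"
    and W: "openin (manifold_topology A) W" and c: "c \<in> B"
  shows "open (snd c ` (fst c \<inter> U \<inter> f -` W))"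
proof -
  have "U \<subseteq> carrier B" using openin_subset[OF U] topspace_manifold_topology[OF B] by simp
  then have "{x \<in> topspace (subtopology (manifold_topology B) U). f x \<in> W} = U \<inter> f -` W"
    using topspace_manifold_topology[OF B] by auto
  then have "openin (subtopology (manifold_topology B) U) (U \<inter> f -` W)"
    using openin_continuous_map_preimage[OF _ W, of "subtopology (manifold_topology B) U" f] f
    by (simp add: smooth_map_on_def)
  then have "openin (manifold_topology B) (U \<inter> f -` W)"
    using openin_trans_full U by blast
  then have "open (snd c ` (U \<inter> f -` W \<inter> fst c))"
    using c unfolding openin_manifold_topology[OF B] by (simp add: atlas_open_def)
  then show ?thesis by (simp add: Int_commute Int_left_commute)
qed

section \<open>One-forms and naturality of the exterior derivative\<close>

text \<open>The function that \<open>ext_deriv\<close> differentiates for a one-form, with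
  \<open>w\<close> held constant.\<close>

definition one_form_coord ::
  "('a, 'e::euclidean_space) chart set \<Rightarrow> ('a, 'e) chart \<Rightarrow> ('a, 'e, 'v) form \<Rightarrow> 'e \<Rightarrow> 'e \<Rightarrow> 'v" where
  "one_form_coord A c \<tau> y w = \<tau> (chart_inv c y) [coord_vec A c (chart_inv c y) w]"

lemma one_form_coord_apply:
  assumes "smooth_atlas A" "c \<in> A" "x \<in> fst c" "v \<in> tangent_space A x"
  shows "one_form_coord A c \<tau> (snd c x) (v c) = \<tau> x [v]"
  by (simp add: one_form_coord_def chart_inv_left[OF assms(1-3)] tangent_space_coord_vec[OF assms(4,2,3)])

lemma one_form_lincomb:
  assumes "smooth_form A 1 \<tau>" "x \<in> carrier A" "v \<in> tangent_space A x" "w \<in> tangent_space A x"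
  shows "\<tau> x [lincomb a v b w] = a *\<^sub>R \<tau> x [v] + b *\<^sub>R \<tau> x [w]"
  using conjunct1[OF assms(1)[unfolded smooth_form_def], rule_format, of x "[v]" 0,
      THEN conjunct1, rule_format, OF assms(2) _ _ assms(3,4), of a b] assms(3)
  by (simp add: tangent_lists_def)

lemma linear_one_form_coord:
  assumes "smooth_atlas A" "smooth_form A 1 \<tau>" "c \<in> A" "x \<in> fst c"
  shows "linear (one_form_coord A c \<tau> (snd c x))"
proof -
  have L: "one_form_coord A c \<tau> (snd c x) (a *\<^sub>R v + b *\<^sub>R w)
      = a *\<^sub>R one_form_coord A c \<tau> (snd c x) v + b *\<^sub>R one_form_coord A c \<tau> (snd c x) w" for a b v w
    unfolding one_form_coord_def chart_inv_left[OF assms(1,3,4)] coord_vec_lincomb[OF assms(1,3,4)]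
    by (rule one_form_lincomb[OF assms(2) in_carrier[OF assms(3,4)]])
      (rule coord_vec_in_tangent_space[OF assms(1,3,4)])+
  show ?thesis
    by (rule linearI) (use L[of 1 _ 1] L[of _ _ 0 0] in auto)
qed

lemma one_form_coord_differentiable:
  assumes "smooth_atlas A" "smooth_form A 1 \<tau>" "c \<in> A" "x \<in> fst c"
  shows "(\<lambda>y. one_form_coord A c \<tau> y w) differentiable (at (snd c x))"
proof -
  have "smooth_on (snd c ` fst c) (\<lambda>y. \<tau> (chart_inv c y) (map (coord_vec A c (chart_inv c y)) [w]))"
    using conjunct2[OF assms(2)[unfolded smooth_form_def], rule_format, OF assms(3), of "[w]"] by simp
  then have "smooth_on (snd c ` fst c) (\<lambda>y. one_form_coord A c \<tau> y w)"
    by (simp add: one_form_coord_def)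
  moreover have "open (snd c ` fst c)" using assms by (auto simp: smooth_atlas_def is_chart_def)
  ultimately show ?thesis
    using smooth_on_D(1)[of _ _ "snd c x"] assms(4) unfolding differentiable_def by blast
qed

lemma ext_deriv_one_form:
  assumes "c = chart_at A x"
  shows "ext_deriv A \<tau> x [v, w] = frechet_derivative (\<lambda>y. one_form_coord A c \<tau> y (w c)) (at (snd c x)) (v c)
    - frechet_derivative (\<lambda>y. one_form_coord A c \<tau> y (v c)) (at (snd c x)) (w c)"
  by (simp add: ext_deriv_def one_form_coord_def Let_def assms lessThan_Suc)

text \<open>Both charts are arbitrary rather than chosen by \<open>chart_at\<close>, so that the
  same computation yields naturality of the exterior derivative and, for the identity map, its
  independence of the chart.\<close>

lemma one_form_coord_pullback:
  fixes \<tau> :: "('a, 'e::euclidean_space, real) form" and \<sigma> :: "('b, 'p::euclidean_space, real) form"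
  assumes B: "smooth_atlas B" and A: "smooth_atlas A" and f: "smooth_in_charts B A f"
    and \<tau>: "smooth_form A 1 \<tau>"
    and \<sigma>: "\<And>q v. q \<in> carrier B \<Longrightarrow> v \<in> tangent_space B q \<Longrightarrow> \<sigma> q [v] = \<tau> (f q) [differential B A f q v]"
    and c: "c \<in> B" "p \<in> fst c" and d: "d \<in> A" "f p \<in> fst d"
  defines "L \<equiv> frechet_derivative (snd d \<circ> f \<circ> chart_inv c) (at (snd c p))"
  shows "frechet_derivative (\<lambda>y. one_form_coord B c \<sigma> y w) (at (snd c p)) v
      - frechet_derivative (\<lambda>y. one_form_coord B c \<sigma> y v) (at (snd c p)) w
    = frechet_derivative (\<lambda>z. one_form_coord A d \<tau> z (L w)) (at (snd d (f p))) (L v)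
      - frechet_derivative (\<lambda>z. one_form_coord A d \<tau> z (L v)) (at (snd d (f p))) (L w)"
proof -
  let ?S = "snd c ` (fst c \<inter> f -` fst d)" and ?g = "snd d \<circ> f \<circ> chart_inv c"
  note D = smooth_in_charts_D[OF f c d]
  have pt: "?g (snd c q) = snd d (f q)" if "q \<in> fst c" for q
    by (simp add: chart_inv_left[OF B c(1) that])
  have lin: "linear (one_form_coord A d \<tau> (?g y))" if y: "y \<in> ?S" for y
  proof -
    obtain q where q: "q \<in> fst c" "f q \<in> fst d" "y = snd c q" using y by blast
    show ?thesis unfolding q(3) pt[OF q(1)] by (rule linear_one_form_coord[OF A \<tau> d(1) q(2)])
  qed
  have s: "one_form_coord B c \<sigma> y w = one_form_coord A d \<tau> (?g y) (frechet_derivative ?g (at y) w)"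
    if y: "y \<in> ?S" for y w
  proof -
    obtain q where q: "q \<in> fst c" "f q \<in> fst d" "y = snd c q" using y by blast
    let ?v = "coord_vec B c q w"
    have v: "?v \<in> tangent_space B q" by (rule coord_vec_in_tangent_space[OF B c(1) q(1)])
    have "one_form_coord B c \<sigma> y w = \<tau> (f q) [differential B A f q ?v]"
      using \<sigma>[OF in_carrier[OF c(1) q(1)] v] by (simp add: one_form_coord_def q(3) chart_inv_left[OF B c(1) q(1)])
    also have "\<dots> = one_form_coord A d \<tau> (snd d (f q)) (differential B A f q ?v d)"
      by (rule one_form_coord_apply[OF A d(1) q(2)
            differential_in_tangent_space[OF B A f in_carrier[OF c(1) q(1)] v], symmetric])
    also have "differential B A f q ?v d = frechet_derivative ?g (at y) w"
      by (simp add: differential_in_chart[OF B f c(1) q(1) d(1) q(2) v] coord_vec_same[OF B c(1) q(1)] q(3))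
    finally show ?thesis by (simp only: pt[OF q(1)] q(3))
  qed
  have t: "(\<lambda>z. one_form_coord A d \<tau> z w) differentiable (at (?g (snd c p)))" for w
    unfolding pt[OF c(2)] by (rule one_form_coord_differentiable[OF A \<tau> d])
  show ?thesis
    using pullback_one_form_ext_deriv[where t = "one_form_coord A d \<tau>" and s = "one_form_coord B c \<sigma>", OF D(2,1,3) lin t s]
    unfolding L_def pt[OF c(2)] by blast
qed

lemma ext_deriv_pullback:
  fixes \<tau> :: "('a, 'e::euclidean_space, real) form" and \<sigma> :: "('b, 'p::euclidean_space, real) form"
  assumes B: "smooth_atlas B" and A: "smooth_atlas A" and f: "smooth_in_charts B A f"
    and \<tau>: "smooth_form A 1 \<tau>"
    and \<sigma>: "\<And>q v. q \<in> carrier B \<Longrightarrow> v \<in> tangent_space B q \<Longrightarrow> \<sigma> q [v] = \<tau> (f q) [differential B A f q v]"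
    and p: "p \<in> carrier B" and v: "v \<in> tangent_space B p" and w: "w \<in> tangent_space B p"
  shows "ext_deriv B \<sigma> p [v, w] = ext_deriv A \<tau> (f p) [differential B A f p v, differential B A f p w]"
proof -
  define c d where "c = chart_at B p" and "d = chart_at A (f p)"
  have c: "c \<in> B" "p \<in> fst c" using chart_at[OF p] by (auto simp: c_def)
  have "f p \<in> carrier A" using f p by (auto simp: smooth_in_charts_def)
  then have d: "d \<in> A" "f p \<in> fst d" using chart_at by (auto simp: d_def)
  show ?thesis
    unfolding ext_deriv_one_form[OF c_def] ext_deriv_one_form[OF d_def]
      differential_in_chart[OF B f c d v] differential_in_chart[OF B f c d w]
    by (rule one_form_coord_pullback[OF B A f \<tau> \<sigma> c d])
qed

text \<open>A change of chart is a pullback along the identity, read in \<open>chart_at A x\<close>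
  on the source side and in \<open>c\<close> on the target side.\<close>

lemma ext_deriv_one_form_in_chart:
  fixes \<tau> :: "('a, 'e::euclidean_space, real) form"
  assumes "smooth_atlas A" "smooth_form A 1 \<tau>" "c \<in> A" "x \<in> fst c"
    and "v \<in> tangent_space A x" "w \<in> tangent_space A x"
  shows "ext_deriv A \<tau> x [v, w] = frechet_derivative (\<lambda>y. one_form_coord A c \<tau> y (w c)) (at (snd c x)) (v c)
    - frechet_derivative (\<lambda>y. one_form_coord A c \<tau> y (v c)) (at (snd c x)) (w c)"
proof -
  define b where "b = chart_at A x"
  have b: "b \<in> A" "x \<in> fst b" using chart_at[OF in_carrier[OF assms(3,4)]] by (auto simp: b_def)
  have u: "frechet_derivative (snd c \<circ> id \<circ> chart_inv b) (at (snd b x)) (u b) = u c"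
    if "u \<in> tangent_space A x" for u
    using tangent_space_change_chart[OF that b(1) assms(3) b(2) assms(4)] by simp
  show ?thesis
    unfolding ext_deriv_one_form[OF b_def]
    using one_form_coord_pullback[OF assms(1,1) smooth_in_charts_id[OF assms(1)] assms(2) _ b assms(3),
        where \<sigma> = \<tau> and v = "v b" and w = "w b"] assms(4) differential_id[OF assms(1)]
    by (simp add: u[OF assms(5), simplified] u[OF assms(6), simplified])
qed

section \<open>The Godbillon--Vey form of a closed one-form\<close>

text \<open>Composition with the transposition permutes the summands and reverses every sign, so the
  sum equals its own negative.\<close>

lemma sum_sign_permutes_eq_0:
  fixes G :: "('b \<Rightarrow> 'b) \<Rightarrow> real"
  assumes "a \<noteq> b" "a \<in> S" "b \<in> S" "finite S"
    and "\<And>\<sigma>. \<sigma> permutes S \<Longrightarrow> G (\<sigma> \<circ> Transposition.transpose a b) = G \<sigma>"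
  shows "(\<Sum>\<sigma> | \<sigma> permutes S. real_of_int (sign \<sigma>) * G \<sigma>) = 0"
proof -
  let ?s = "\<Sum>\<sigma> | \<sigma> permutes S. real_of_int (sign \<sigma>) * G \<sigma>"
  have t: "Transposition.transpose a b permutes S" using assms(2,3) by (rule permutes_swap_id)
  have "?s = (\<Sum>\<sigma> | \<sigma> permutes S. real_of_int (sign (\<sigma> \<circ> Transposition.transpose a b)) * G (\<sigma> \<circ> Transposition.transpose a b))"
    by (rule sum_permutations_compose_right[OF t])
  also have "\<dots> = (\<Sum>\<sigma> | \<sigma> permutes S. - (real_of_int (sign \<sigma>) * G \<sigma>))"
  proof (rule sum.cong)
    fix \<sigma> assume "\<sigma> \<in> {\<sigma>. \<sigma> permutes S}"
    then have s: "\<sigma> permutes S" by simp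
    have "sign (\<sigma> \<circ> Transposition.transpose a b) = - sign \<sigma>"
      using sign_compose[of \<sigma> "Transposition.transpose a b"] permutation_permutes assms(1,4) s
      by (auto simp: sign_swap_id permutation_swap_id)
    then show "real_of_int (sign (\<sigma> \<circ> Transposition.transpose a b)) * G (\<sigma> \<circ> Transposition.transpose a b) = - (real_of_int (sign \<sigma>) * G \<sigma>)"
      by (simp add: assms(5)[OF s])
  qed simp
  also have "\<dots> = - ?s" by (rule sum_negf)
  finally show ?thesis by simp
qed

lemma wedge_one_forms:
  fixes \<alpha> \<beta> :: "('a, 'e, real) form"
  shows "wedge (*) 1 1 \<alpha> \<beta> x [v, w] = \<alpha> x [v] * \<beta> x [w] - \<alpha> x [w] * \<beta> x [v]"
proof -
  have "{..<2::nat} = {0, 1}" by auto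
  then have *: "{\<sigma>. \<sigma> permutes {..<2::nat}} = {id, Transposition.transpose 0 1}"
    by (auto simp: permutes_doubleton_iff)
  have "id \<noteq> Transposition.transpose 0 (1::nat)" by (metis id_apply transpose_apply_first zero_neq_one)
  then show ?thesis
    unfolding wedge_def one_add_one * by (simp add: sign_swap_id upt_rec)
qed

text \<open>Insert \<open>z\<close> into the second slot of \<tau> \<and> \<alpha> = 0.\<close>

lemma one_form_proportional:
  fixes \<tau> \<alpha> :: "('a, 'e::euclidean_space, real) form"
  assumes "form_eq A 2 (ext_deriv A \<tau>) (wedge (*) 1 1 \<tau> \<alpha>)" "form_eq A 2 (ext_deriv A \<tau>) zero_form"
    and "x \<in> carrier A" "z \<in> tangent_space A x" "\<tau> x [z] = 1" "v \<in> tangent_space A x"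
  shows "\<alpha> x [v] = \<alpha> x [z] * \<tau> x [v]"
proof -
  have "[v, z] \<in> tangent_lists A 2 x" using assms by (simp add: tangent_lists_def)
  then have "wedge (*) 1 1 \<tau> \<alpha> x [v, z] = 0"
    using assms(1-3) by (auto simp: form_eq_def zero_form_def)
  then show ?thesis by (simp add: wedge_one_forms[unfolded One_nat_def] assms(5) algebra_simps)
qed

text \<open>Pointwise this is \<tau> \<and> \<eta> \<and> \<tau> = 0: after expanding
  \<open>\<beta>\<close>, each term of the sum over permutations carries the factor
  \<open>\<tau>\<close> in two slots.\<close>

lemma wedge_one_two_eq_0:
  fixes \<alpha> \<beta> \<tau> \<eta> :: "('a, 'e::euclidean_space, real) form"
  assumes x: "x \<in> carrier A" and us: "us \<in> tangent_lists A 3 x"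
    and \<alpha>: "\<And>v. v \<in> tangent_space A x \<Longrightarrow> \<alpha> x [v] = a * \<tau> x [v]"
    and \<beta>: "\<And>v w. v \<in> tangent_space A x \<Longrightarrow> w \<in> tangent_space A x \<Longrightarrow>
      \<beta> x [v, w] = \<eta> x [v] * \<tau> x [w] - \<eta> x [w] * \<tau> x [v]"
  shows "wedge (*) 1 2 \<alpha> \<beta> x us = 0"
proof -
  define t e where "t i = \<tau> x [us ! i]" and "e i = \<eta> x [us ! i]" for i
  have u: "us ! i \<in> tangent_space A x" if "i < 3" for i
    using us that nth_mem[of i us] by (auto simp: tangent_lists_def)
  have \<sigma>: "\<sigma> i < 3" if "\<sigma> permutes {..<3}" "i < 3" for \<sigma> :: "nat \<Rightarrow> nat" and i
    using permutes_in_image[OF that(1), of i] that(2) by simp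
  have l: "[0..<Suc 0] = [0]" "[Suc 0..<3] = [1, 2]" by (simp_all add: upt_rec)
  have "(\<Sum>\<sigma> | \<sigma> permutes {..<3}. real_of_int (sign \<sigma>) *
        (\<alpha> x (map (\<lambda>i. us ! \<sigma> i) [0..<Suc 0]) * \<beta> x (map (\<lambda>i. us ! \<sigma> i) [Suc 0..<3])))
      = (\<Sum>\<sigma> | \<sigma> permutes {..<3}. real_of_int (sign \<sigma>) * (a * t (\<sigma> 0) * e (\<sigma> 1) * t (\<sigma> 2))
        - real_of_int (sign \<sigma>) * (a * t (\<sigma> 0) * e (\<sigma> 2) * t (\<sigma> 1)))"
  proof (rule sum.cong)
    fix \<sigma> :: "nat \<Rightarrow> nat" assume "\<sigma> \<in> {\<sigma>. \<sigma> permutes {..<3}}"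
    then have "us ! \<sigma> i \<in> tangent_space A x" if "i < 3" for i using u[OF \<sigma>[OF _ that]] by simp
    from \<alpha>[OF this[of 0]] \<beta>[OF this[of 1] this[of 2]]
    show "real_of_int (sign \<sigma>) *
        (\<alpha> x (map (\<lambda>i. us ! \<sigma> i) [0..<Suc 0]) * \<beta> x (map (\<lambda>i. us ! \<sigma> i) [Suc 0..<3]))
      = real_of_int (sign \<sigma>) * (a * t (\<sigma> 0) * e (\<sigma> 1) * t (\<sigma> 2))
        - real_of_int (sign \<sigma>) * (a * t (\<sigma> 0) * e (\<sigma> 2) * t (\<sigma> 1))"
      unfolding l by (simp add: t_def e_def) (simp add: algebra_simps)
  qed simp
  also have "\<dots> = (\<Sum>\<sigma> | \<sigma> permutes {..<3}. real_of_int (sign \<sigma>) * (a * t (\<sigma> 0) * e (\<sigma> 1) * t (\<sigma> 2)))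
      - (\<Sum>\<sigma> | \<sigma> permutes {..<3}. real_of_int (sign \<sigma>) * (a * t (\<sigma> 0) * e (\<sigma> 2) * t (\<sigma> 1)))"
    by (rule sum_subtractf)
  \<comment> \<open>Here the repeated factor \<open>t\<close> sits in slots 0 and 2, in the next sum
    in slots 0 and 1; exchanging these slots leaves the product unchanged.\<close>
  also have "(\<Sum>\<sigma> | \<sigma> permutes {..<3::nat}. real_of_int (sign \<sigma>) * (a * t (\<sigma> 0) * e (\<sigma> 1) * t (\<sigma> 2))) = 0"
    by (rule sum_sign_permutes_eq_0[of 0 2]) (auto simp: Transposition.transpose_def)
  also have "(\<Sum>\<sigma> | \<sigma> permutes {..<3::nat}. real_of_int (sign \<sigma>) * (a * t (\<sigma> 0) * e (\<sigma> 2) * t (\<sigma> 1))) = 0"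
    by (rule sum_sign_permutes_eq_0[of 0 1]) (auto simp: Transposition.transpose_def)
  finally have sum_0: "(\<Sum>\<sigma> | \<sigma> permutes {..<3}. real_of_int (sign \<sigma>) *
      (\<alpha> x (map (\<lambda>i. us ! \<sigma> i) [0..<Suc 0]) * \<beta> x (map (\<lambda>i. us ! \<sigma> i) [Suc 0..<3]))) = 0"
    by simp
  have 3: "1 + 2 = (3::nat)" by simp
  show ?thesis
    unfolding wedge_def 3 unfolding One_nat_def real_scaleR_def sum_0 by simp
qed

text \<open>The Leibniz rule for the product of a function and a one-form. \<open>L\<close> is the
  differential of \<open>f\<close> written in the chart \<open>c\<close>, and the product formula
  for \<open>\<alpha>\<close> is needed on the whole chart domain because it gets
  differentiated.\<close>

lemma ext_deriv_scaled_one_form: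
  fixes \<tau> \<alpha> :: "('a, 'e::euclidean_space, real) form"
  assumes A: "smooth_atlas A" and \<tau>: "smooth_form A 1 \<tau>" and \<alpha>: "smooth_form A 1 \<alpha>"
    and c: "c \<in> A" "x \<in> fst c"
    and f: "(f \<circ> chart_inv c) differentiable (at (snd c x))"
    and eq: "\<And>y v. y \<in> fst c \<Longrightarrow> v \<in> tangent_space A y \<Longrightarrow> \<alpha> y [v] = f y * \<tau> y [v]"
    and v: "v \<in> tangent_space A x" and w: "w \<in> tangent_space A x"
  defines "L \<equiv> frechet_derivative (f \<circ> chart_inv c) (at (snd c x))"
  shows "ext_deriv A \<alpha> x [v, w] = L (v c) * \<tau> x [w] - L (w c) * \<tau> x [v] + f x * ext_deriv A \<tau> x [v, w]"
proof -
  have op: "open (snd c ` fst c)" using A c by (auto simp: smooth_atlas_def is_chart_def)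
  have D: "frechet_derivative (\<lambda>y. one_form_coord A c \<alpha> y (u c)) (at (snd c x)) =
      (\<lambda>h. f x * frechet_derivative (\<lambda>y. one_form_coord A c \<tau> y (u c)) (at (snd c x)) h
        + L h * \<tau> x [u])" if u: "u \<in> tangent_space A x" for u
  proof (rule frechet_derivative_eqI)
    have "((\<lambda>y. (f \<circ> chart_inv c) y * one_form_coord A c \<tau> y (u c)) has_derivative
      (\<lambda>h. (f \<circ> chart_inv c) (snd c x)
          * frechet_derivative (\<lambda>y. one_form_coord A c \<tau> y (u c)) (at (snd c x)) h
        + L h * one_form_coord A c \<tau> (snd c x) (u c))) (at (snd c x))"
      unfolding L_def using f one_form_coord_differentiable[OF A \<tau> c]
      by (intro has_derivative_mult frechet_derivative_works[THEN iffD1])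
    then have "((\<lambda>y. (f \<circ> chart_inv c) y * one_form_coord A c \<tau> y (u c)) has_derivative
      (\<lambda>h. f x * frechet_derivative (\<lambda>y. one_form_coord A c \<tau> y (u c)) (at (snd c x)) h
        + L h * \<tau> x [u])) (at (snd c x))"
      by (simp add: chart_inv_left[OF A c] one_form_coord_apply[OF A c u])
    then show "((\<lambda>y. one_form_coord A c \<alpha> y (u c)) has_derivative
      (\<lambda>h. f x * frechet_derivative (\<lambda>y. one_form_coord A c \<tau> y (u c)) (at (snd c x)) h
        + L h * \<tau> x [u])) (at (snd c x))"
    proof (rule has_derivative_transform_within_open[OF _ op])
      show "snd c x \<in> snd c ` fst c" using c by simp
      show "(f \<circ> chart_inv c) y * one_form_coord A c \<tau> y (u c) = one_form_coord A c \<alpha> y (u c)"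
        if "y \<in> snd c ` fst c" for y
        using that eq coord_vec_in_tangent_space[OF A c(1)]
        by (auto simp: one_form_coord_def chart_inv_left[OF A c(1)])
    qed
  qed
  show ?thesis
    unfolding ext_deriv_one_form_in_chart[OF A \<alpha> c v w] ext_deriv_one_form_in_chart[OF A \<tau> c v w] D[OF v] D[OF w]
    by (simp add: algebra_simps)
qed

text \<open>Expanding \<open>Z\<close> in the basis makes the contraction a finite sum of products
  of differentiable coefficients. It supplies the factor for the Leibniz rule.\<close>

lemma contraction_differentiable:
  fixes \<alpha> :: "('a, 'e::euclidean_space, real) form"
  assumes A: "smooth_atlas A" and \<alpha>: "smooth_form A 1 \<alpha>" and Z: "smooth_vector_field A Z"
    and c: "c \<in> A" "x \<in> fst c"
  shows "((\<lambda>y. \<alpha> y [Z y]) \<circ> chart_inv c) differentiable (at (snd c x))"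
proof -
  have op: "open (snd c ` fst c)" using A c by (auto simp: smooth_atlas_def is_chart_def)
  have x: "snd c x \<in> snd c ` fst c" using c by simp
  have "smooth_on (snd c ` fst c) (\<lambda>y. Z (chart_inv c y) c)"
    using Z c(1) by (auto simp: smooth_vector_field_def)
  from smooth_on_D(1)[OF this op x]
  have Zd: "(\<lambda>y. Z (chart_inv c y) c) differentiable (at (snd c x))" by (rule differentiableI)
  have "(\<lambda>y. \<Sum>b\<in>Basis. (Z (chart_inv c y) c \<bullet> b) * one_form_coord A c \<alpha> y b) differentiable (at (snd c x))"
    by (intro differentiable_sum ballI differentiable_mult differentiable_inner Zd differentiable_const
        one_form_coord_differentiable[OF A \<alpha> c] finite_Basis)
  then obtain D where "((\<lambda>y. \<Sum>b\<in>Basis. (Z (chart_inv c y) c \<bullet> b) * one_form_coord A c \<alpha> y b)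
      has_derivative D) (at (snd c x))" by (auto simp: differentiable_def)
  then have "(((\<lambda>y. \<alpha> y [Z y]) \<circ> chart_inv c) has_derivative D) (at (snd c x))"
  proof (rule has_derivative_transform_within_open[OF _ op x])
    fix y assume "y \<in> snd c ` fst c"
    then obtain q where q: "q \<in> fst c" "y = snd c q" by blast
    have lin: "linear (one_form_coord A c \<alpha> y)"
      unfolding q by (rule linear_one_form_coord[OF A \<alpha> c(1) q(1)])
    have "Z q \<in> tangent_space A q"
      using Z in_carrier[OF c(1) q(1)] by (auto simp: smooth_vector_field_def)
    then have "\<alpha> q [Z q] = one_form_coord A c \<alpha> y (Z q c)"
      unfolding q by (rule one_form_coord_apply[OF A c(1) q(1), symmetric])
    also have "\<dots> = one_form_coord A c \<alpha> y (\<Sum>b\<in>Basis. (Z q c \<bullet> b) *\<^sub>R b)"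
      by (simp add: euclidean_representation)
    also have "\<dots> = (\<Sum>b\<in>Basis. (Z q c \<bullet> b) * one_form_coord A c \<alpha> y b)"
      by (simp only: linear_sum[OF lin] linear_scale[OF lin] real_scaleR_def)
    finally show "(\<Sum>b\<in>Basis. (Z (chart_inv c y) c \<bullet> b) * one_form_coord A c \<alpha> y b) = ((\<lambda>y. \<alpha> y [Z y]) \<circ> chart_inv c) y"
      by (simp add: q(2) chart_inv_left[OF A c(1) q(1)])
  qed
  then show ?thesis by (rule differentiableI)
qed

lemma godbillon_vey_form_eq_0:
  fixes \<tau> \<alpha> :: "('a, 'e::euclidean_space, real) form"
  assumes A: "smooth_atlas A" and \<tau>: "smooth_form A 1 \<tau>" and \<alpha>: "smooth_form A 1 \<alpha>"
    and Z: "smooth_vector_field A Z" "\<And>x. x \<in> carrier A \<Longrightarrow> \<tau> x [Z x] = 1"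
    and d: "form_eq A 2 (ext_deriv A \<tau>) (wedge (*) 1 1 \<tau> \<alpha>)" and closed: "form_eq A 2 (ext_deriv A \<tau>) zero_form"
  shows "form_eq A 3 (wedge (*) 1 2 \<alpha> (ext_deriv A \<alpha>)) zero_form"
  unfolding form_eq_def
proof (intro ballI)
  fix x us assume x: "x \<in> carrier A" and us: "us \<in> tangent_lists A 3 x"
  define c where "c = chart_at A x"
  have c: "c \<in> A" "x \<in> fst c" using chart_at[OF x] by (auto simp: c_def)
  let ?f = "\<lambda>x. \<alpha> x [Z x]"
  let ?L = "frechet_derivative (?f \<circ> chart_inv c) (at (snd c x))"
  have scaled: "\<alpha> y [v] = ?f y * \<tau> y [v]" if "y \<in> carrier A" "v \<in> tangent_space A y" for y v
    using one_form_proportional[OF d closed that(1) _ Z(2)[OF that(1)] that(2)] Z(1) that(1)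
    by (simp add: smooth_vector_field_def)
  have d\<alpha>: "ext_deriv A \<alpha> x [v, w] = ?L (v c) * \<tau> x [w] - ?L (w c) * \<tau> x [v]"
    if v: "v \<in> tangent_space A x" and w: "w \<in> tangent_space A x" for v w
  proof -
    have "ext_deriv A \<alpha> x [v, w] = ?L (v c) * \<tau> x [w] - ?L (w c) * \<tau> x [v] + ?f x * ext_deriv A \<tau> x [v, w]"
      by (rule ext_deriv_scaled_one_form[OF A \<tau> \<alpha> c contraction_differentiable[OF A \<alpha> Z(1) c] scaled v w])
        (rule in_carrier[OF c(1)])
    moreover have "ext_deriv A \<tau> x [v, w] = 0"
      using closed x v w by (auto simp: form_eq_def tangent_lists_def zero_form_def)
    ultimately show ?thesis by simp
  qed
  \<comment> \<open>The one-form \<open>\<eta>\<close> is the differential of \<open>?f\<close> at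
    the fixed point \<open>x\<close>, in the chart \<open>c\<close>; hence it ignores its point
    argument and reads the head of the list.\<close>
  have "wedge (*) 1 2 \<alpha> (ext_deriv A \<alpha>) x us = 0"
    by (rule wedge_one_two_eq_0[where a = "?f x" and \<tau> = \<tau> and \<eta> = "\<lambda>_ vs. ?L (hd vs c)", OF x us])
      (rule scaled[OF x], assumption, simp add: d\<alpha>)
  then show "wedge (*) 1 2 \<alpha> (ext_deriv A \<alpha>) x us = zero_form x us"
    by (simp add: zero_form_def)
qed

text \<open>A form that vanishes in the sense of \<open>form_eq\<close> need not equal
  \<open>zero_form\<close> as a function, whereas cohomology classes are compared as sets. The form
  enters its class only through \<open>form_eq\<close>, which bridges the two.\<close>

lemma de_rham_class_cong:
  assumes "form_eq A k \<omega> \<omega>'"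
  shows "de_rham_class A k \<omega> = de_rham_class A k \<omega>'"
proof -
  have *: "form_eq A k (\<lambda>x vs. \<eta> x vs - \<omega> x vs) \<beta> \<longleftrightarrow> form_eq A k (\<lambda>x vs. \<eta> x vs - \<omega>' x vs) \<beta>" for \<eta> \<beta>
    using assms by (simp add: form_eq_def)
  show ?thesis by (simp only: de_rham_class_def exact_form_def *)
qed

section \<open>Frames and the soldering form\<close>

lemma bij_betw_coord_vec:
  assumes "smooth_atlas A" "c \<in> A" "x \<in> fst c"
  shows "bij_betw (coord_vec A c x) UNIV (tangent_space A x)"
  unfolding bij_betw_def
proof
  show "inj (coord_vec A c x)" by (metis coord_vec_same[OF assms] injI)
  show "range (coord_vec A c x) = tangent_space A x"
    using coord_vec_in_tangent_space[OF assms] tangent_space_coord_vec[OF _ assms(2,3)] by (metis rangeI subsetI image_subsetI subset_antisym)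
qed

text \<open>These frames show that a bundle chart reaches every invertible matrix. For
  \<open>M = mat 1\<close> the frame is the coordinate frame itself, which matters in the integrable
  case.\<close>

lemma coord_frame:
  fixes M :: "real ^ 'n::finite ^ 'n"
  assumes "smooth_atlas A" "c \<in> A" "x \<in> fst c" "det M \<noteq> 0"
  shows "(x, \<lambda>w. coord_vec A c x (M *v w)) \<in> frame_bundle A"
    and "frame_matrix c (x, \<lambda>w. coord_vec A c x (M *v w)) = M"
proof -
  have "bij ((*v) M)" using assms(4) by (simp add: invertible_det_nz[symmetric] invertible_eq_bij)
  from bij_betw_trans[OF this bij_betw_coord_vec[OF assms(1-3)]]
  show "(x, \<lambda>w. coord_vec A c x (M *v w)) \<in> frame_bundle A"
    using in_carrier[OF assms(2,3)]
    by (simp add: frame_bundle_def o_def matrix_vector_right_distrib matrix_vector_mult_scaleR coord_vec_lincomb[OF assms(1-3)])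
  show "frame_matrix c (x, \<lambda>w. coord_vec A c x (M *v w)) = M"
    by (simp add: frame_matrix_def coord_vec_same[OF assms(1-3)])
qed

lemma linear_frame:
  fixes A :: "('a, real ^ 'n::finite) chart set"
  assumes "p \<in> frame_bundle A"
  shows "linear (\<lambda>w. snd p w c)"
proof -
  have "snd p (a *\<^sub>R v + b *\<^sub>R w) = lincomb a (snd p v) b (snd p w)" for a b v w
    using assms by (auto simp: frame_bundle_def)
  from this[of 1 _ 1] this[of _ _ 0 0] show ?thesis
    by (intro linearI) (simp_all add: lincomb_def)
qed

lemma frame_bij:
  "p \<in> frame_bundle A \<Longrightarrow> bij_betw (snd p) UNIV (tangent_space A (fst p))"
  by (auto simp: frame_bundle_def)

lemma frame_matrix_mult:
  assumes "p \<in> frame_bundle A"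
  shows "frame_matrix c p *v w = snd p w c"
  unfolding frame_matrix_def by (rule matrix_works) (simp add: linear_frame[OF assms] linear_matrix_vector_mul_eq)

lemma det_frame_matrix:
  assumes "smooth_atlas A" "p \<in> frame_bundle A" "c \<in> A" "fst p \<in> fst c"
  shows "det (frame_matrix c p) \<noteq> 0"
  unfolding frame_matrix_def det_nz_iff_inj[OF linear_frame[OF assms(2)]]
proof (rule injI)
  fix v w assume eq: "snd p v c = snd p w c"
  have "snd p u \<in> tangent_space A (fst p)" for u
    using frame_bij[OF assms(2)] by (auto simp: bij_betw_def)
  then have "snd p v = snd p w"
    using eq tangent_space_coord_vec[OF _ assms(3,4)] by metis
  then show "v = w"
    using frame_bij[OF assms(2)] by (auto simp: bij_betw_def dest: injD)
qed

lemma inj_on_frame_chart: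
  assumes "smooth_atlas A" "c \<in> A"
  shows "inj_on (\<lambda>p. (snd c (fst p), frame_matrix c p)) {p \<in> frame_bundle A. fst p \<in> fst c}"
proof (rule inj_onI, clarsimp)
  fix x u y v
  assume p: "(x, u) \<in> frame_bundle A" "x \<in> fst c" and q: "(y, v) \<in> frame_bundle A" "y \<in> fst c"
    and eq: "snd c x = snd c y" "frame_matrix c (x, u) = frame_matrix c (y, v)"
  have xy: "x = y" using eq(1) p(2) q(2) chart_inv_left[OF assms] by metis
  have "u w \<in> tangent_space A x" "v w \<in> tangent_space A x" "u w c = v w c" for w
    using frame_bij[OF p(1)] frame_bij[OF q(1)] frame_matrix_mult[OF p(1), of c w]
      frame_matrix_mult[OF q(1), of c w] eq(2) xy by (auto simp: bij_betw_def)
  then have "u w = v w" for w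
    using tangent_space_coord_vec[OF _ assms(2) p(2)] by metis
  with xy show "x = y \<and> u = v" by auto
qed

text \<open>In every bundle chart the set becomes an open subset of the model space times the
  invertible matrices, and the latter are open because the determinant is continuous.\<close>

lemma openin_frame_atlas:
  fixes A :: "('a, real ^ 'n::finite) chart set"
  assumes A: "smooth_atlas A" and c: "c \<in> A"
  shows "openin (manifold_topology (frame_atlas A)) {p \<in> frame_bundle A. fst p \<in> fst c}"
proof -
  have op: "openin (manifold_topology (frame_atlas A)) = atlas_open (frame_atlas A)"
    by (rule openin_manifold_topology_inj) 
      (unfold frame_atlas_def, erule imageE, simp only: fst_conv snd_conv inj_on_frame_chart[OF A])
  have *: "(\<lambda>p. (snd d (fst p), frame_matrix d p)) `
      ({p \<in> frame_bundle A. fst p \<in> fst c} \<inter> {p \<in> frame_bundle A. fst p \<in> fst d})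
      = (snd d ` (fst c \<inter> fst d)) \<times> {M. det M \<noteq> 0}" (is "?l = ?r") if d: "d \<in> A" for d
  proof
    show "?l \<subseteq> ?r" using det_frame_matrix[OF A _ d] by auto
    show "?r \<subseteq> ?l"
    proof clarsimp
      fix x u and M :: "real ^ 'n ^ 'n"
      assume x: "x \<in> fst c" "x \<in> fst d" and M: "det M \<noteq> 0"
      show "(snd d x, M) \<in> ?l"
        using x coord_frame[OF A d x(2) M]
        by (intro image_eqI[where x = "(x, \<lambda>w. coord_vec A d x (M *v w))"]) auto
    qed
  qed
  have "open {M :: real ^ 'n ^ 'n. det M \<noteq> 0}"
    unfolding det_def by (intro open_Collect_neq continuous_intros)
  moreover have "open (snd d ` (fst c \<inter> fst d))" if "d \<in> A" for d
    using A c that by (auto simp: smooth_atlas_def compatible_def)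
  ultimately have "open (snd d ` ({p \<in> frame_bundle A. fst p \<in> fst c} \<inter> fst d))" if "d \<in> frame_atlas A" for d
    using that * by (auto simp: frame_atlas_def open_Times)
  then show ?thesis
    unfolding op atlas_open_def using c by (auto simp: frame_atlas_def carrier_def)
qed

text \<open>In a bundle chart the inclusion of \<open>P\<close> reads as the pair of base
  coordinates and frame matrix. Continuity of the embedding gives the open domain, its smoothness
  gives both components.\<close>

lemma G_structure_charts:
  fixes A :: "('a, real ^ 'n::finite) chart set"
  assumes A: "smooth_atlas A" and G: "G_structure A G P \<P>" and C: "C \<in> \<P>" and c: "c \<in> A"
  shows "open (snd C ` (fst C \<inter> fst -` fst c))"
    and "smooth_on (snd C ` (fst C \<inter> fst -` fst c)) (snd c \<circ> fst \<circ> chart_inv C)"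
    and "smooth_on (snd C ` (fst C \<inter> fst -` fst c)) (\<lambda>y. frame_matrix c (chart_inv C y))"
proof -
  let ?d = "({p \<in> frame_bundle A. fst p \<in> fst c}, \<lambda>p. (snd c (fst p), frame_matrix c p))"
  let ?S = "snd C ` (fst C \<inter> fst -` fst c)"
  have \<P>: "smooth_atlas \<P>" and P: "carrier \<P> = P" "P \<subseteq> frame_bundle A"
    and emb: "smooth_map_on \<P> (frame_atlas A) P (\<lambda>p. p)"
    using G by (auto simp: G_structure_def manifold_atlas_def smooth_embedding_def)
  have d: "?d \<in> frame_atlas A" using c by (auto simp: frame_atlas_def)
  have sub: "fst C \<subseteq> P" using C P by (auto simp: carrier_def)
  then have eq: "fst C \<inter> P \<inter> (\<lambda>p. p) -` {p \<in> frame_bundle A. fst p \<in> fst c} = fst C \<inter> fst -` fst c"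
    using P by auto
  have "openin (manifold_topology \<P>) P"
    using topspace_manifold_topology[OF \<P>] P openin_topspace by metis
  from open_chart_image_preimage[OF \<P> emb this openin_frame_atlas[OF A c] C]
  show op: "open ?S" unfolding eq .
  have "smooth_on (snd C ` (fst C \<inter> P \<inter> (\<lambda>p. p) -` fst ?d)) (snd ?d \<circ> (\<lambda>p. p) \<circ> chart_inv C)"
    using emb C d unfolding smooth_map_on_def by blast
  then have sm: "smooth_on ?S (\<lambda>y. (snd c (fst (chart_inv C y)), frame_matrix c (chart_inv C y)))"
    by (simp add: eq[simplified] o_def)
  show "smooth_on ?S (snd c \<circ> fst \<circ> chart_inv C)"
    using smooth_on_bounded_linear[OF bounded_linear_fst op sm] by (simp add: o_def)
  show "smooth_on ?S (\<lambda>y. frame_matrix c (chart_inv C y))"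
    using smooth_on_bounded_linear[OF bounded_linear_snd op sm] by simp
qed

lemma smooth_in_charts_projection:
  assumes "smooth_atlas A" "G_structure A G P \<P>"
  shows "smooth_in_charts \<P> A fst"
proof -
  have "carrier \<P> \<subseteq> frame_bundle A" using assms(2) by (auto simp: G_structure_def)
  then show ?thesis
    unfolding smooth_in_charts_def using G_structure_charts[OF assms]
    by (auto simp: frame_bundle_def)
qed

text \<open>A frame is onto the tangent space, not onto all families of components, so the
  \<open>inv\<close> in the soldering form is meaningful only because the differential of the
  projection takes values in the tangent space.\<close>

lemma frame_soldering_form:
  fixes A :: "('a, real ^ 'n::finite) chart set"
  assumes A: "smooth_atlas A" and G: "G_structure A G P \<P>" and p: "p \<in> carrier \<P>"
    and v: "v \<in> tangent_space \<P> p"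
  shows "snd p (soldering_form A \<P> p [v]) = differential \<P> A fst p v"
proof -
  have \<P>: "smooth_atlas \<P>" and pF: "p \<in> frame_bundle A"
    using G p by (auto simp: G_structure_def manifold_atlas_def)
  have "range (snd p) = tangent_space A (fst p)"
    using frame_bij[OF pF] by (simp add: bij_betw_def)
  moreover have "differential \<P> A fst p v \<in> tangent_space A (fst p)"
    by (rule differential_in_tangent_space[OF \<P> A smooth_in_charts_projection[OF A G] p v])
  ultimately show ?thesis
    by (simp add: soldering_form_def f_inv_into_f)
qed

text \<open>In coordinates the soldering form solves a linear system whose matrix is that of the frame.\<close>

lemma soldering_form_differentiable:
  fixes A :: "('a, real ^ 'n::finite) chart set"
  assumes A: "smooth_atlas A" and G: "G_structure A G P \<P>" and C: "C \<in> \<P>" "p \<in> fst C"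
  shows "(\<lambda>y. one_form_coord \<P> C (soldering_form A \<P>) y w) differentiable (at (snd C p))"
proof -
  have \<P>: "smooth_atlas \<P>" and P: "carrier \<P> \<subseteq> frame_bundle A"
    using G by (auto simp: G_structure_def manifold_atlas_def)
  note \<pi> = smooth_in_charts_projection[OF A G]
  define c where "c = chart_at A (fst p)"
  have "fst p \<in> carrier A" using P in_carrier[OF C] by (auto simp: frame_bundle_def)
  then have c: "c \<in> A" "fst p \<in> fst c" using chart_at by (auto simp: c_def)
  let ?S = "snd C ` (fst C \<inter> fst -` fst c)" and ?g = "snd c \<circ> fst \<circ> chart_inv C"
  note S = G_structure_charts[OF A G C(1) c(1)]
  have pS: "snd C p \<in> ?S" using C c by auto
  show ?thesis
  proof (rule solve_linear_system_differentiable[OF S(1) pS,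
        where M = "\<lambda>y. frame_matrix c (chart_inv C y)" and b = "\<lambda>y. frechet_derivative ?g (at y) w"])
    show "(\<lambda>y. frame_matrix c (chart_inv C y) $ i $ j) differentiable (at (snd C p))" for i j
      by (rule differentiableI)
        (rule bounded_linear.has_derivative[OF bounded_linear_vec_nth
          bounded_linear.has_derivative[OF bounded_linear_vec_nth smooth_on_D(1)[OF S(3,1) pS]]])
    show "(\<lambda>y. frechet_derivative ?g (at y) w $ i) differentiable (at (snd C p))" for i
      by (rule differentiableI)
        (rule bounded_linear.has_derivative[OF bounded_linear_vec_nth smooth_on_D(2)[OF S(2,1) pS]])
    fix y assume "y \<in> ?S"
    then obtain q where q: "q \<in> fst C" "fst q \<in> fst c" "y = snd C q" by blast
    let ?v = "coord_vec \<P> C q w"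
    have qc: "q \<in> carrier \<P>" by (rule in_carrier[OF C(1) q(1)])
    then have qF: "q \<in> frame_bundle A" using P by blast
    have v: "?v \<in> tangent_space \<P> q" by (rule coord_vec_in_tangent_space[OF \<P> C(1) q(1)])
    have "frame_matrix c q *v soldering_form A \<P> q [?v] = differential \<P> A fst q ?v c"
      by (simp add: frame_matrix_mult[OF qF] frame_soldering_form[OF A G qc v])
    also have "\<dots> = frechet_derivative ?g (at y) w"
      by (simp add: differential_in_chart[OF \<P> \<pi> C(1) q(1) c(1) q(2) v] coord_vec_same[OF \<P> C(1) q(1)] q(3))
    finally show "det (frame_matrix c (chart_inv C y)) \<noteq> 0 \<and>
        frame_matrix c (chart_inv C y) *v one_form_coord \<P> C (soldering_form A \<P>) y w = frechet_derivative ?g (at y) w"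
      using det_frame_matrix[OF A qF c(1) q(2)]
      by (simp add: one_form_coord_def q(3) chart_inv_left[OF \<P> C(1) q(1)])
  qed
qed

section \<open>Vanishing torsion and integrability\<close>

text \<open>Along any curve in the group the first row is constantly the first unit row, so its
  derivative vanishes.\<close>

lemma lie_algebra_G_arist:
  fixes X :: "real ^ 'n::_ ^ 'n::{finite, wellorder}"
  assumes "X \<in> lie_algebra G_arist"
  shows "X $ ix0 $ j = 0"
proof -
  obtain k where k: "\<And>t. k t \<in> G_arist" and d: "(k has_vector_derivative X) (at 0)"
    using assms by (auto simp: lie_algebra_def)
  have "((\<lambda>t. k t $ ix0 $ j) has_vector_derivative X $ ix0 $ j) (at 0)"
    by (rule bounded_linear.has_vector_derivative[OF bounded_linear_vec_nth
          bounded_linear.has_vector_derivative[OF bounded_linear_vec_nth d]])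
  moreover have "(\<lambda>t. k t $ ix0 $ j) = (\<lambda>t. if j = ix0 then 1 else 0)"
    using k by (auto simp: G_arist_def fun_eq_iff)
  ultimately have "((\<lambda>t::real. if j = ix0 then 1 else 0 :: real) has_vector_derivative X $ ix0 $ j) (at 0)"
    by simp
  then show ?thesis
    using vector_derivative_unique_at has_vector_derivative_const by blast
qed

text \<open>Every summand applies a matrix with vanishing first row to some vector, whatever the
  form \<open>\<theta>\<close> is.\<close>

lemma wedge_connection_component:
  fixes \<omega> :: "('b, 'p::euclidean_space, real ^ 'n::_ ^ 'n::{finite, wellorder}) form"
  assumes "\<And>v. v \<in> tangent_space \<P> p \<Longrightarrow> \<omega> p [v] \<in> lie_algebra G_arist"
    and "vs \<in> tangent_lists \<P> 2 p"
  shows "wedge (*v) 1 1 \<omega> \<theta> p vs $ ix0 = 0"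
proof -
  have "(\<omega> p (map (\<lambda>i. vs ! \<sigma> i) [0..<1]) *v u) $ ix0 = 0" if "\<sigma> permutes {..<1 + 1}" for \<sigma> u
  proof -
    have "\<sigma> 0 < length vs"
      using permutes_in_image[OF that, of 0] assms(2) by (simp add: tangent_lists_def)
    then have "vs ! \<sigma> 0 \<in> tangent_space \<P> p"
      using assms(2) nth_mem by (force simp: tangent_lists_def)
    from lie_algebra_G_arist[OF assms(1)[OF this]] show ?thesis
      by (simp add: matrix_vector_mult_def)
  qed
  then show ?thesis
    unfolding wedge_def by (simp add: sum_component del: upt_Suc One_nat_def)
qed

text \<open>Taking a component commutes with \<open>frechet_derivative\<close> only at points of
  differentiability; this is where the differentiability of the soldering form enters.\<close>

lemma ext_deriv_soldering_component:
  fixes A :: "('a, real ^ 'n::finite) chart set"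
  assumes A: "smooth_atlas A" and G: "G_structure A G P \<P>" and p: "p \<in> carrier \<P>"
  shows "ext_deriv \<P> (soldering_form A \<P>) p [v, w] $ k
    = ext_deriv \<P> (\<lambda>q vs. soldering_form A \<P> q vs $ k) p [v, w]"
proof -
  let ?\<theta> = "soldering_form A \<P>"
  define C where "C = chart_at \<P> p"
  have C: "C \<in> \<P>" "p \<in> fst C" using chart_at[OF p] by (auto simp: C_def)
  have "frechet_derivative (\<lambda>y. one_form_coord \<P> C (\<lambda>q vs. ?\<theta> q vs $ k) y u) (at (snd C p))
      = (\<lambda>h. frechet_derivative (\<lambda>y. one_form_coord \<P> C ?\<theta> y u) (at (snd C p)) h $ k)" for u
  proof (rule frechet_derivative_eqI)
    show "((\<lambda>y. one_form_coord \<P> C (\<lambda>q vs. ?\<theta> q vs $ k) y u) has_derivative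
      (\<lambda>h. frechet_derivative (\<lambda>y. one_form_coord \<P> C ?\<theta> y u) (at (snd C p)) h $ k)) (at (snd C p))"
      using bounded_linear.has_derivative[OF bounded_linear_vec_nth
          soldering_form_differentiable[OF A G C, unfolded frechet_derivative_works]]
      by (simp add: one_form_coord_def)
  qed
  then show ?thesis by (simp add: ext_deriv_one_form[OF C_def])
qed

text \<open>A local section \<open>s\<close> satisfies \<open>fst (s y) = y\<close>, so by the chain
  rule its derivative is a right inverse of the derivative of the projection at
  \<open>p = s x\<close>.\<close>

lemma tangent_projection_surj:
  fixes A :: "('a, real ^ 'n::finite) chart set"
  assumes A: "smooth_atlas A" and G: "G_structure A G P \<P>" and x: "x \<in> carrier A"
  obtains p where "p \<in> carrier \<P>" "fst p = x"
    "\<And>v. v \<in> tangent_space A x \<Longrightarrow> \<exists>u\<in>tangent_space \<P> p. differential \<P> A fst p u = v"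
proof -
  have \<P>: "smooth_atlas \<P>" using G by (auto simp: G_structure_def manifold_atlas_def)
  note \<pi> = smooth_in_charts_projection[OF A G]
  have G_sections: "\<forall>x\<in>carrier A. \<exists>U s. openin (manifold_topology A) U \<and> x \<in> U \<and>
      smooth_map_on A \<P> U s \<and> (\<forall>y\<in>U. fst (s y) = y)"
    using G unfolding G_structure_def by (elim conjE)
  obtain U s where U: "openin (manifold_topology A) U" "x \<in> U" and s: "smooth_map_on A \<P> U s"
    and fst_s: "\<And>y. y \<in> U \<Longrightarrow> fst (s y) = y"
    using bspec[OF G_sections x] by (elim exE conjE) blast
  let ?p = "s x"
  have "s ` topspace (subtopology (manifold_topology A) U) \<subseteq> topspace (manifold_topology \<P>)"
    using s by (auto simp: smooth_map_on_def continuous_map_def)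
  then have p: "?p \<in> carrier \<P>"
    using U(2) x by (auto simp: topspace_manifold_topology[OF A] topspace_manifold_topology[OF \<P>])
  then obtain C where C: "C \<in> \<P>" "?p \<in> fst C" by (auto simp: carrier_def)
  obtain c where c: "c \<in> A" "x \<in> fst c" using x by (auto simp: carrier_def)
  have fp: "fst ?p = x" by (rule fst_s[OF U(2)])
  let ?T = "snd c ` (fst c \<inter> U \<inter> s -` fst C)"
  let ?s = "snd C \<circ> s \<circ> chart_inv c" and ?g = "snd c \<circ> fst \<circ> chart_inv C"
  have T: "open ?T" by (rule open_chart_image_preimage[OF A s U(1) openin_chart_domain[OF \<P> C(1)] c(1)])
  have xT: "snd c x \<in> ?T" using c U C by blast
  have "smooth_on ?T ?s" using s c(1) C(1) by (auto simp: smooth_map_on_def)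
  from smooth_on_D(1)[OF this T xT]
  have ds: "(?s has_derivative frechet_derivative ?s (at (snd c x))) (at (snd c x))" .
  have "?s (snd c x) = snd C ?p" by (simp add: chart_inv_left[OF A c])
  with smooth_in_charts_D(4)[OF \<pi> C c(1), unfolded fp, OF c(2)]
  have dg: "(?g has_derivative frechet_derivative ?g (at (snd C ?p))) (at (?s (snd c x)))" by simp
  have "((\<lambda>y. ?g (?s y)) has_derivative
      (\<lambda>h. frechet_derivative ?g (at (snd C ?p)) (frechet_derivative ?s (at (snd c x)) h))) (at (snd c x))"
    by (rule has_derivative_compose[OF ds dg])
  then have "((\<lambda>y. y) has_derivative
      (\<lambda>h. frechet_derivative ?g (at (snd C ?p)) (frechet_derivative ?s (at (snd c x)) h))) (at (snd c x))"
  proof (rule has_derivative_transform_within_open[OF _ T xT])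
    fix y assume "y \<in> ?T"
    then obtain q where "q \<in> fst c" "q \<in> U" "s q \<in> fst C" "y = snd c q" by blast
    then show "?g (?s y) = y"
      by (simp add: chart_inv_left[OF A c(1)] chart_inv_left[OF \<P> C(1)] fst_s)
  qed
  then have id: "frechet_derivative ?g (at (snd C ?p)) (frechet_derivative ?s (at (snd c x)) h) = h" for h
    using has_derivative_unique[OF has_derivative_ident] by metis
  have "\<exists>u\<in>tangent_space \<P> ?p. differential \<P> A fst ?p u = v" if v: "v \<in> tangent_space A x" for v
  proof
    \<comment> \<open>The image of \<open>v\<close> under the derivative of the section, written in
      the chart \<open>C\<close>.\<close>
    let ?u = "coord_vec \<P> C ?p (frechet_derivative ?s (at (snd c x)) (v c))"
    show u: "?u \<in> tangent_space \<P> ?p" by (rule coord_vec_in_tangent_space[OF \<P> C])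
    have "differential \<P> A fst ?p ?u c = v c"
      using differential_in_chart[OF \<P> \<pi> C c(1) _ u] c(2) by (simp add: fp coord_vec_same[OF \<P> C] id)
    moreover have "differential \<P> A fst ?p ?u \<in> tangent_space A x"
      using differential_in_tangent_space[OF \<P> A \<pi> p u] fp by simp
    ultimately show "differential \<P> A fst ?p ?u = v"
      using tangent_space_coord_vec[OF v c] tangent_space_coord_vec[OF _ c] by metis
  qed
  with p fp show ?thesis by (rule that)
qed

lemma torsion_free_imp_closed:
  fixes A :: "('a, real ^ 'n::{finite, wellorder}) chart set"
    and \<P> :: "(('a, 'n) frame, 'p::euclidean_space) chart set"
  assumes A: "smooth_atlas A" and \<tau>: "smooth_form A 1 \<tau>" and G: "G_structure A G_arist P \<P>"
    and P: "P = aristotelian_frames A \<tau> Z \<gamma> h"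
    and \<omega>: "ehresmann_connection G_arist \<P> \<omega>"
    and torsion: "form_eq \<P> 2 (torsion A \<P> \<omega>) zero_form"
  shows "form_eq A 2 (ext_deriv A \<tau>) zero_form"
  unfolding form_eq_def
proof (intro ballI)
  fix x vs assume x: "x \<in> carrier A" and vs: "vs \<in> tangent_lists A 2 x"
  then obtain v w where vw: "vs = [v, w]" "v \<in> tangent_space A x" "w \<in> tangent_space A x"
    by (auto simp: tangent_lists_def length_Suc_conv numeral_2_eq_2)
  have \<P>: "smooth_atlas \<P>" and carrier: "carrier \<P> = P" using G by (auto simp: G_structure_def manifold_atlas_def)
  obtain p where p: "p \<in> carrier \<P>" "fst p = x"
    and surj: "\<And>v. v \<in> tangent_space A x \<Longrightarrow> \<exists>u\<in>tangent_space \<P> p. differential \<P> A fst p u = v"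
    by (rule tangent_projection_surj[OF A G x]) blast
  obtain v' w' where v': "v' \<in> tangent_space \<P> p" "differential \<P> A fst p v' = v"
    and w': "w' \<in> tangent_space \<P> p" "differential \<P> A fst p w' = w"
    using surj vw by metis
  let ?\<sigma> = "\<lambda>q vs. soldering_form A \<P> q vs $ ix0"
  \<comment> \<open>The frame \<open>snd q\<close> carries the soldering form back to the projected
    vector, and on frames in \<open>P\<close> the form \<open>\<tau>\<close> reads off the
    coordinate \<open>ix0\<close>.\<close>
  have \<sigma>: "?\<sigma> q [u] = \<tau> (fst q) [differential \<P> A fst q u]"
    if "q \<in> carrier \<P>" "u \<in> tangent_space \<P> q" for q u
  proof -
    have "\<tau> (fst q) [snd q z] = z $ ix0" for z
      using that(1) carrier P by (auto simp: aristotelian_frames_def)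
    then show ?thesis using frame_soldering_form[OF A G that] by metis
  qed
  have l: "[v', w'] \<in> tangent_lists \<P> 2 p" using v' w' by (simp add: tangent_lists_def)
  have "torsion A \<P> \<omega> p [v', w'] = 0"
    using torsion p(1) l by (simp add: form_eq_def zero_form_def)
  then have "(ext_deriv \<P> (soldering_form A \<P>) p [v', w']
      + wedge (*v) 1 1 \<omega> (soldering_form A \<P>) p [v', w']) $ ix0 = 0"
    by (simp add: torsion_def)
  moreover have "wedge (*v) 1 1 \<omega> (soldering_form A \<P>) p [v', w'] $ ix0 = 0"
    using \<omega> p(1) by (intro wedge_connection_component[OF _ l]) (auto simp: ehresmann_connection_def)
  ultimately have "ext_deriv \<P> ?\<sigma> p [v', w'] = 0"
    using ext_deriv_soldering_component[OF A G p(1), of v' w' ix0] by simp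
  moreover have "ext_deriv \<P> ?\<sigma> p [v', w'] = ext_deriv A \<tau> x [v, w]"
    using ext_deriv_pullback[OF \<P> A smooth_in_charts_projection[OF A G] \<tau> \<sigma> p(1) v'(1) w'(1)]
    by (simp add: p(2) v' w')
  ultimately show "ext_deriv A \<tau> x vs = zero_form x vs"
    by (simp add: vw zero_form_def)
qed

lemma mat_1_in_G_arist: "mat 1 \<in> G_arist"
  using orthogonal_matrix_id by (auto simp: G_arist_def mat_def)

lemma integrable_imp_closed:
  fixes A :: "('a, real ^ 'n::{finite, wellorder}) chart set"
  assumes A: "smooth_atlas A" and \<tau>: "smooth_form A 1 \<tau>"
    and P: "P = aristotelian_frames A \<tau> Z \<gamma> h"
    and integrable: "integrable_G_structure A G_arist P"
  shows "form_eq A 2 (ext_deriv A \<tau>) zero_form"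
  unfolding form_eq_def
proof (intro ballI)
  fix x vs assume x: "x \<in> carrier A" and vs: "vs \<in> tangent_lists A 2 x"
  then obtain v w where vw: "vs = [v, w]" "v \<in> tangent_space A x" "w \<in> tangent_space A x"
    by (auto simp: tangent_lists_def length_Suc_conv numeral_2_eq_2)
  obtain c where c: "c \<in> A" "x \<in> fst c"
    and flat: "\<And>p. p \<in> frame_bundle A \<Longrightarrow> fst p \<in> fst c \<Longrightarrow> p \<in> P \<longleftrightarrow> frame_matrix c p \<in> G_arist"
    using integrable x unfolding integrable_G_structure_def by blast
  have op: "open (snd c ` fst c)" using A c by (auto simp: smooth_atlas_def is_chart_def)
  \<comment> \<open>The coordinate frame has matrix 1 in the flat chart, hence belongs to
    \<open>P\<close>, and frames in \<open>P\<close> give \<open>\<tau>\<close> its standard value.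
    So \<open>\<tau>\<close> has constant coefficients on the chart.\<close>
  have coord: "one_form_coord A c \<tau> y u = u $ ix0" if y: "y \<in> snd c ` fst c" for y u
  proof -
    obtain q where q: "q \<in> fst c" "y = snd c q" using y by blast
    note F = coord_frame[OF A c(1) q(1), of "mat 1"]
    have "(q, coord_vec A c q) \<in> P"
      using flat[of "(q, coord_vec A c q)"] F q(1) mat_1_in_G_arist by simp
    then show ?thesis
      by (auto simp: P aristotelian_frames_def one_form_coord_def q(2) chart_inv_left[OF A c(1) q(1)])
  qed
  have "frechet_derivative (\<lambda>y. one_form_coord A c \<tau> y u) (at (snd c x)) = (\<lambda>_. 0)" for u
    by (rule frechet_derivative_eqI, rule has_derivative_transform_within_open[OF has_derivative_const op])
      (use c coord in auto)
  then show "ext_deriv A \<tau> x vs = zero_form x vs"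
    by (simp add: vw(1) ext_deriv_one_form_in_chart[OF A \<tau> c vw(2,3)] zero_form_def)
qed

theorem mainTheorem2:
  fixes A F :: "('a, real ^ 'n::{finite, wellorder}) chart set"
    and \<tau> \<alpha> :: "('a, real ^ 'n::_, real) form"
    and Z :: "'a \<Rightarrow> ('a, real ^ 'n::_) tvec"
    and \<gamma> :: "'a \<Rightarrow> (('a, real ^ 'n::_) tvec \<Rightarrow> real) \<Rightarrow> (('a, real ^ 'n::_) tvec \<Rightarrow> real) \<Rightarrow> real"
    and h :: "'a \<Rightarrow> ('a, real ^ 'n::_) tvec \<Rightarrow> ('a, real ^ 'n::_) tvec \<Rightarrow> real"
    and P :: "('a, 'n) frame set"
    and \<P> :: "(('a, 'n) frame, 'p::euclidean_space) chart set"
  assumes "smooth_manifold A"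
    and "integrable_aristotelian_structure A \<tau> Z \<gamma> h"
    and "G_structure A G_arist P \<P>"
    and "P = aristotelian_frames A \<tau> Z \<gamma> h"
    and "foliated_atlas A F"
    and "\<forall>x\<in>carrier A. foliation_tangent A F x = {v \<in> tangent_space A x. \<tau> x [v] = 0}"
    and "smooth_form A 1 \<alpha>"
    and "form_eq A 2 (ext_deriv A \<tau>) (wedge (*) 1 1 \<tau> \<alpha>)"
    and "godbillon_vey_class A \<alpha> \<noteq> de_rham_class A 3 zero_form"
  shows "(\<forall>\<omega>. ehresmann_connection G_arist \<P> \<omega> \<longrightarrow> \<not> form_eq \<P> 2 (torsion A \<P> \<omega>) zero_form)
    \<and> \<not> integrable_G_structure A G_arist P"
proof -
  have A: "smooth_atlas A" using assms(1) by (simp add: smooth_manifold_def manifold_atlas_def)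
  have \<tau>: "smooth_form A 1 \<tau>" and Z: "smooth_vector_field A Z" "\<And>x. x \<in> carrier A \<Longrightarrow> \<tau> x [Z x] = 1"
    using assms(2) by (auto simp: integrable_aristotelian_structure_def aristotelian_structure_def)
  \<comment> \<open>Otherwise \<alpha> \<and> d\<alpha> would vanish pointwise and have the class of
    \<open>zero_form\<close>, against the assumption on the Godbillon-Vey class.\<close>
  have "\<not> form_eq A 2 (ext_deriv A \<tau>) zero_form"
    using godbillon_vey_form_eq_0[OF A \<tau> assms(7) Z assms(8), THEN de_rham_class_cong] assms(9)
    by (auto simp: godbillon_vey_class_def)
  then show ?thesis
    using torsion_free_imp_closed[OF A \<tau> assms(3,4)] integrable_imp_closed[OF A \<tau> assms(4)] by blast
qed

end
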